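(* Let $(M,g)$ be a pseudo-Riemannian manifold, $\nabla$ an affine connection on $M$ (possibly with torsion), $\eta$ a $1$-form on $M$, and $\phi,\psi$ smooth functions on $M$. Let $(\widetilde g,\widetilde\nabla)$ be the conformal-projective transformation of $(g,\nabla)$: $$\widetilde g:=e^{\phi+\psi}g,\qquad \widetilde\nabla_XY:=\nabla_XY+d\phi(X)Y+d\phi(Y)X-g(X,Y)\nabla\psi ,$$ where $\nabla\psi$ denotes the gradient of $\psi$ with respect to $g$. Then: (i) $(M,g,\eta,\nabla)$ is a semi-Weyl manifold admitting torsion (SWMT) if and only if $(M,\widetilde g,\eta,\widetilde\nabla)$ is a SWMT. Moreover, the semi-dual connection $\widetilde\nabla^*_{(\widetilde g,\eta)}$ of $\widetilde\nabla$ with respect to $(\widetilde g,\eta)$ and the semi-dual connection $\nabla^*_{(g,\eta)}$ of $\nabla$ with respect to $(g,\eta)$ satisfy $$\widetilde\nabla^*_{(\widetilde g,\eta)}=\nabla^*_{(g,\eta)}+d\psi\otimes I+I\otimes d\psi-g\otimes\nabla\phi .$$ (ii) $(M,g,\nabla)$ is a statistical manifold admitting torsion (SMT) if and only if $(M,\widetilde g,\widetilde\nabla)$ is a SMT. Moreover, the dual connection $\widetilde\nabla^*_{\widetilde g}$ of $\widetilde\nabla$ with respect to $\widetilde g$ and the dual connection $\nabla^*_g$ of $\nabla$ with respect to $g$ satisfy $$\widetilde\nabla^*_{\widetilde g}=\nabla^*_g+d\psi\otimes I+I\otimes d\psi-g\otimes\nabla\phi .$$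
   Context: All objects are smooth; $\Gamma^\infty(TM)$ denotes vector fields on $M$. The torsion of an affine connection is $T^\nabla(X,Y)=\nabla_XY-\nabla_YX-[X,Y]$, and $(\nabla_Xg)(Y,Z)=X(g(Y,Z))-g(\nabla_XY,Z)-g(Y,\nabla_XZ)$. $(M,g,\nabla)$ is a SMT if $(\nabla_Xg)(Y,Z)=(\nabla_Yg)(X,Z)-g(T^\nabla(X,Y),Z)$ for all $X,Y,Z\in\Gamma^\infty(TM)$. $(M,g,\eta,\nabla)$ is a SWMT if $(\nabla_Xg)(Y,Z)+\eta(X)g(Y,Z)=(\nabla_Yg)(X,Z)+\eta(Y)g(X,Z)-g(T^\nabla(X,Y),Z)$ for all $X,Y,Z\in\Gamma^\infty(TM)$. The dual connection $\nabla^*_g$ of $\nabla$ with respect to $g$ is defined by $X(g(Y,Z))=g(\nabla_XY,Z)+g(Y,(\nabla^*_g)_XZ)$; the semi-dual connection $\nabla^*_{(g,\eta)}$ of $\nabla$ with respect to $(g,\eta)$ is defined by $X(g(Y,Z))=g(\nabla_XY,Z)+g(Y,(\nabla^*_{(g,\eta)})_XZ)-\eta(X)g(Y,Z)$, for all $X,Y,Z$. Notation: for a smooth function $f$, $\nabla f$ is the gradient of $f$ with respect to $g$, and $(d\psi\otimes I+I\otimes d\psi-g\otimes\nabla\phi)(X,Y)=d\psi(X)Y+d\psi(Y)X-g(X,Y)\nabla\phi$. *)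

theory Defs
  imports "HOL-Analysis.Analysis" "HOL-Library.Function_Algebras"
begin

section \<open>Smooth maps between Euclidean spaces\<close>

text \<open>All iterated directional derivatives up to order \<open>k\<close> exist and are continuous; in finite
  dimension this is \<open>C\<^sup>k\<close>. Only used for open \<open>S\<close>.\<close>

primrec Ck_on ::
  "nat \<Rightarrow> 'e::euclidean_space set \<Rightarrow> ('e \<Rightarrow> 'f::real_normed_vector) \<Rightarrow> bool" where
  "Ck_on 0 S f \<longleftrightarrow> continuous_on S f"
| "Ck_on (Suc k) S f \<longleftrightarrow>
     (\<forall>x\<in>S. f differentiable (at x)) \<and>
     (\<forall>u. Ck_on k S (\<lambda>x. frechet_derivative f (at x) u))"

definition smooth_on ::
  "'e::euclidean_space set \<Rightarrow> ('e \<Rightarrow> 'f::real_normed_vector) \<Rightarrow> bool" where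
  "smooth_on S f \<longleftrightarrow> (\<forall>k. Ck_on k S f)"

section \<open>Smooth manifolds\<close>

text \<open>The manifold \<open>M\<close> is the whole type \<open>'a\<close>, whose classes provide the Hausdorff and second
  countability axioms; \<open>'e\<close> is the model space. A chart is a pair \<open>(U, x)\<close> of an open domain and
  a coordinate map, of which only the values on \<open>U\<close> matter. Atlases need not be maximal.\<close>

type_synonym ('a, 'e) atlas = "('a set \<times> ('a \<Rightarrow> 'e)) set"

definition smooth_manifold ::
  "('a::{t2_space,second_countable_topology}, 'e::euclidean_space) atlas \<Rightarrow> bool" where
  "smooth_manifold A \<longleftrightarrow>
     (\<Union>(U, x)\<in>A. U) = UNIV \<and>
     (\<forall>(U, x)\<in>A. open U \<and> open (x ` U) \<and> homeomorphism U (x ` U) x (inv_into U x)) \<and>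
     (\<forall>(U, x)\<in>A. \<forall>(V, y)\<in>A. smooth_on (x ` (U \<inter> V)) (y \<circ> inv_into U x))"

definition smooth_fun ::
  "('a::{t2_space,second_countable_topology}, 'e::euclidean_space) atlas \<Rightarrow> ('a \<Rightarrow> real) \<Rightarrow> bool"
where
  "smooth_fun A f \<longleftrightarrow> (\<forall>(U, x)\<in>A. smooth_on (x ` U) (f \<circ> inv_into U x))"

section \<open>Tangent vectors, vector fields, one-forms\<close>

text \<open>A tangent vector is the derivation \<open>\<Sum>\<^sub>i u\<^sup>i \<partial>/\<partial>x\<^sup>i\<close> at \<open>p\<close> acting on
  \<open>C\<^sup>\<infinity>(M)\<close>. Off \<open>C\<^sup>\<infinity>(M)\<close> it takes the value 0 by convention, so that equality of tangent
  vectors is equality of HOL functions. The vector space operations are the pointwise ones.\<close>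

type_synonym 'a tvec = "('a \<Rightarrow> real) \<Rightarrow> real"
type_synonym 'a vfield = "'a \<Rightarrow> 'a tvec"
type_synonym 'a form1 = "'a \<Rightarrow> 'a tvec \<Rightarrow> real"
type_synonym 'a form2 = "'a \<Rightarrow> 'a tvec \<Rightarrow> 'a tvec \<Rightarrow> real"
type_synonym 'a connection = "'a vfield \<Rightarrow> 'a vfield \<Rightarrow> 'a vfield"

definition coord_tvec ::
  "('a::{t2_space,second_countable_topology}, 'e::euclidean_space) atlas \<Rightarrow>
   'a set \<times> ('a \<Rightarrow> 'e) \<Rightarrow> 'a \<Rightarrow> 'e \<Rightarrow> 'a tvec" where
  "coord_tvec A = (\<lambda>(U, x) p u f.
     if smooth_fun A f then frechet_derivative (f \<circ> inv_into U x) (at (x p)) u else 0)"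

definition tangent_space ::
  "('a::{t2_space,second_countable_topology}, 'e::euclidean_space) atlas \<Rightarrow> 'a \<Rightarrow> 'a tvec set"
where
  "tangent_space A p = {coord_tvec A (U, x) p u | U x u. (U, x) \<in> A \<and> p \<in> U}"

definition tscale :: "real \<Rightarrow> 'a tvec \<Rightarrow> 'a tvec" where
  "tscale a v = (\<lambda>f. a * v f)"

definition apply_field :: "'a vfield \<Rightarrow> ('a \<Rightarrow> real) \<Rightarrow> ('a \<Rightarrow> real)" where
  "apply_field X f = (\<lambda>p. X p f)"

definition vector_fields ::
  "('a::{t2_space,second_countable_topology}, 'e::euclidean_space) atlas \<Rightarrow> 'a vfield set" where
  "vector_fields A = {X. (\<forall>p. X p \<in> tangent_space A p) \<and>
     (\<forall>f. smooth_fun A f \<longrightarrow> smooth_fun A (apply_field X f))}"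

definition fscale :: "('a \<Rightarrow> real) \<Rightarrow> 'a vfield \<Rightarrow> 'a vfield"  (infixr "\<odot>" 75) where
  "h \<odot> X = (\<lambda>p. tscale (h p) (X p))"

definition lie_bracket :: "'a vfield \<Rightarrow> 'a vfield \<Rightarrow> 'a vfield" where
  "lie_bracket X Y = (\<lambda>p f. X p (apply_field Y f) - Y p (apply_field X f))"

definition eval1 :: "'a form1 \<Rightarrow> 'a vfield \<Rightarrow> ('a \<Rightarrow> real)" where
  "eval1 \<eta> X = (\<lambda>p. \<eta> p (X p))"

definition eval2 :: "'a form2 \<Rightarrow> 'a vfield \<Rightarrow> 'a vfield \<Rightarrow> ('a \<Rightarrow> real)" where
  "eval2 g X Y = (\<lambda>p. g p (X p) (Y p))"

definition one_form ::
  "('a::{t2_space,second_countable_topology}, 'e::euclidean_space) atlas \<Rightarrow> 'a form1 \<Rightarrow> bool" where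
  "one_form A \<eta> \<longleftrightarrow>
     (\<forall>p. \<forall>v\<in>tangent_space A p. \<forall>w\<in>tangent_space A p. \<eta> p (v + w) = \<eta> p v + \<eta> p w) \<and>
     (\<forall>p. \<forall>v\<in>tangent_space A p. \<forall>a. \<eta> p (tscale a v) = a * \<eta> p v) \<and>
     (\<forall>X\<in>vector_fields A. smooth_fun A (eval1 \<eta> X))"

definition differential :: "('a \<Rightarrow> real) \<Rightarrow> 'a form1" where
  "differential f = (\<lambda>p v. v f)"

section \<open>Metrics and connections\<close>

definition pseudo_riemannian_metric ::
  "('a::{t2_space,second_countable_topology}, 'e::euclidean_space) atlas \<Rightarrow> 'a form2 \<Rightarrow> bool" where
  "pseudo_riemannian_metric A g \<longleftrightarrow>
     (\<forall>p. \<forall>v\<in>tangent_space A p. \<forall>w\<in>tangent_space A p. g p v w = g p w v) \<and>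
     (\<forall>p. \<forall>u\<in>tangent_space A p. \<forall>v\<in>tangent_space A p. \<forall>w\<in>tangent_space A p.
        g p (u + v) w = g p u w + g p v w) \<and>
     (\<forall>p. \<forall>v\<in>tangent_space A p. \<forall>w\<in>tangent_space A p. \<forall>a. g p (tscale a v) w = a * g p v w) \<and>
     (\<forall>p. \<forall>v\<in>tangent_space A p. (\<forall>w\<in>tangent_space A p. g p v w = 0) \<longrightarrow> v = 0) \<and>
     (\<forall>X\<in>vector_fields A. \<forall>Y\<in>vector_fields A. smooth_fun A (eval2 g X Y))"

definition affine_connection ::
  "('a::{t2_space,second_countable_topology}, 'e::euclidean_space) atlas \<Rightarrow> 'a connection \<Rightarrow> bool"
where
  "affine_connection A D \<longleftrightarrow>
     (\<forall>X\<in>vector_fields A. \<forall>Y\<in>vector_fields A. D X Y \<in> vector_fields A) \<and>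
     (\<forall>X\<in>vector_fields A. \<forall>Y\<in>vector_fields A. \<forall>Z\<in>vector_fields A.
        D (X + Y) Z = D X Z + D Y Z \<and> D X (Y + Z) = D X Y + D X Z) \<and>
     (\<forall>h. smooth_fun A h \<longrightarrow> (\<forall>X\<in>vector_fields A. \<forall>Y\<in>vector_fields A.
        D (h \<odot> X) Y = h \<odot> D X Y \<and>
        D X (h \<odot> Y) = apply_field X h \<odot> Y + h \<odot> D X Y))"

definition torsion :: "'a connection \<Rightarrow> 'a connection" where
  "torsion D X Y = D X Y - D Y X - lie_bracket X Y"

definition cov_metric ::
  "'a connection \<Rightarrow> 'a form2 \<Rightarrow> 'a vfield \<Rightarrow> 'a vfield \<Rightarrow> 'a vfield \<Rightarrow> ('a \<Rightarrow> real)" where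
  "cov_metric D g X Y Z =
     apply_field X (eval2 g Y Z) - eval2 g (D X Y) Z - eval2 g Y (D X Z)"

definition SMT ::
  "('a::{t2_space,second_countable_topology}, 'e::euclidean_space) atlas \<Rightarrow>
   'a form2 \<Rightarrow> 'a connection \<Rightarrow> bool" where
  "SMT A g D \<longleftrightarrow>
     smooth_manifold A \<and> pseudo_riemannian_metric A g \<and> affine_connection A D \<and>
     (\<forall>X\<in>vector_fields A. \<forall>Y\<in>vector_fields A. \<forall>Z\<in>vector_fields A.
        cov_metric D g X Y Z = cov_metric D g Y X Z - eval2 g (torsion D X Y) Z)"

definition SWMT ::
  "('a::{t2_space,second_countable_topology}, 'e::euclidean_space) atlas \<Rightarrow>
   'a form2 \<Rightarrow> 'a form1 \<Rightarrow> 'a connection \<Rightarrow> bool" where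
  "SWMT A g \<eta> D \<longleftrightarrow>
     smooth_manifold A \<and> pseudo_riemannian_metric A g \<and> one_form A \<eta> \<and> affine_connection A D \<and>
     (\<forall>X\<in>vector_fields A. \<forall>Y\<in>vector_fields A. \<forall>Z\<in>vector_fields A.
        cov_metric D g X Y Z + eval1 \<eta> X * eval2 g Y Z =
        cov_metric D g Y X Z + eval1 \<eta> Y * eval2 g X Z - eval2 g (torsion D X Y) Z)"

text \<open>The gradient and the dual connections are the unique smooth vector fields with the
  defining property; existence and uniqueness rest on the nondegeneracy of \<open>g\<close>.\<close>

definition grad ::
  "('a::{t2_space,second_countable_topology}, 'e::euclidean_space) atlas \<Rightarrow>
   'a form2 \<Rightarrow> ('a \<Rightarrow> real) \<Rightarrow> 'a vfield" where
  "grad A g f = (THE W. W \<in> vector_fields A \<and>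
     (\<forall>X\<in>vector_fields A. eval2 g W X = eval1 (differential f) X))"

definition dual_connection ::
  "('a::{t2_space,second_countable_topology}, 'e::euclidean_space) atlas \<Rightarrow>
   'a form2 \<Rightarrow> 'a connection \<Rightarrow> 'a connection" where
  "dual_connection A g D X Z = (THE W. W \<in> vector_fields A \<and>
     (\<forall>Y\<in>vector_fields A.
        apply_field X (eval2 g Y Z) = eval2 g (D X Y) Z + eval2 g Y W))"

definition semi_dual_connection ::
  "('a::{t2_space,second_countable_topology}, 'e::euclidean_space) atlas \<Rightarrow>
   'a form2 \<Rightarrow> 'a form1 \<Rightarrow> 'a connection \<Rightarrow> 'a connection" where
  "semi_dual_connection A g \<eta> D X Z = (THE W. W \<in> vector_fields A \<and>
     (\<forall>Y\<in>vector_fields A.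
        apply_field X (eval2 g Y Z) =
        eval2 g (D X Y) Z + eval2 g Y W - eval1 \<eta> X * eval2 g Y Z))"

section \<open>Conformal-projective transformations\<close>

text \<open>\<open>d\<alpha> \<otimes> I + I \<otimes> d\<alpha> - g \<otimes> \<nabla>\<beta>\<close>, where \<open>\<nabla>\<beta>\<close> is the gradient of \<open>\<beta>\<close>
  with respect to \<open>g\<close>.\<close>

definition cp_tensor ::
  "('a::{t2_space,second_countable_topology}, 'e::euclidean_space) atlas \<Rightarrow>
   'a form2 \<Rightarrow> ('a \<Rightarrow> real) \<Rightarrow> ('a \<Rightarrow> real) \<Rightarrow> 'a connection" where
  "cp_tensor A g \<alpha> \<beta> X Y =
     eval1 (differential \<alpha>) X \<odot> Y + eval1 (differential \<alpha>) Y \<odot> X - eval2 g X Y \<odot> grad A g \<beta>"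

definition cp_metric :: "'a form2 \<Rightarrow> ('a \<Rightarrow> real) \<Rightarrow> ('a \<Rightarrow> real) \<Rightarrow> 'a form2" where
  "cp_metric g \<phi> \<psi> = (\<lambda>p v w. exp (\<phi> p + \<psi> p) * g p v w)"

definition cp_connection ::
  "('a::{t2_space,second_countable_topology}, 'e::euclidean_space) atlas \<Rightarrow>
   'a form2 \<Rightarrow> 'a connection \<Rightarrow> ('a \<Rightarrow> real) \<Rightarrow> ('a \<Rightarrow> real) \<Rightarrow> 'a connection" where
  "cp_connection A g D \<phi> \<psi> X Y = D X Y + cp_tensor A g \<phi> \<psi> X Y"

end

theory Submission
  imports Defs "HOL-Real_Asymp.Real_Asymp"
begin

text \<open>Gradients and dual connections are defined by unique choice, so they carry information only
  once a Riesz representation is available: every functional on vector fields that is linear over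
  the smooth functions is \<open>g(W, -)\<close> for a unique smooth field \<open>W\<close>. Bump functions make such
  functionals pointwise and extend coordinate frames to global fields; nondegeneracy solves for
  \<open>W\<close> at each point, and Gaussian elimination in a local frame shows that \<open>W\<close> is smooth.

  Given this, the terms of the transformed connection cancel against the derivative
  \<open>d\<phi> + d\<psi>\<close> of the conformal factor: the defect of the SWMT condition is multiplied by
  \<open>exp (\<phi> + \<psi>)\<close>, and the asserted field has the defining property of the new semi-dual connection.
  Part (ii) is part (i) for \<open>\<eta> = 0\<close>.\<close>

section \<open>Calculus of smooth maps\<close>

text \<open>Tangent vectors are derivations on globally defined smooth functions, and connections
  act on global fields, so nothing can simply be restricted to a chart: coordinates and coordinate
  fields have to be cut off and extended by zero. A closed set containing the support is carried
  along, because smoothness at a point outside the chart needs an open neighbourhood on which the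
  extension vanishes.

  The exchange of \<phi> and \<psi> in the dual has an algebraic origin. Pairing the correction of
  D_X Y with Z gives d\<phi>(X) g(Y,Z) + d\<phi>(Y) g(X,Z) - d\<psi>(Z) g(X,Y); pairing the asserted
  correction of the dual of Z with Y gives d\<psi>(X) g(Y,Z) + d\<psi>(Z) g(X,Y) - d\<phi>(Y)
  g(X,Z). In the sum the mixed terms cancel and (d\<phi> + d\<psi>)(X) g(Y,Z) is left, exactly what
  differentiating the conformal factor contributes. The \<eta> term is a multiple of the metric and
  is merely rescaled.\<close>

lemma frechet_derivative_cong_open:
  assumes "open S" "x \<in> S" "\<And>z. z \<in> S \<Longrightarrow> f z = g z" "f differentiable (at x)"
  shows "g differentiable (at x)" "frechet_derivative g (at x) = frechet_derivative f (at x)"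
proof -
  have "(g has_derivative frechet_derivative f (at x)) (at x)"
    using iffD1[OF frechet_derivative_works assms(4)] assms(1-3)
    by (rule has_derivative_transform_within_open)
  then show "g differentiable (at x)" "frechet_derivative g (at x) = frechet_derivative f (at x)"
    using frechet_derivative_at[of g "frechet_derivative f (at x)" x]
    by (auto simp: differentiable_def)
qed

text \<open>\<open>frechet_derivative\<close> is taken in the ambient space, so agreement on
  \<open>S\<close> passes to the derivatives because the open set \<open>S\<close> contains a ball
  around each of its points.\<close>

lemma Ck_on_cong:
  assumes "open S" "\<And>z. z \<in> S \<Longrightarrow> f z = g z" "Ck_on k S f"
  shows "Ck_on k S g"
  using assms(2,3)
proof (induction k arbitrary: f g)
  case 0
  then show ?case using continuous_on_cong[of S S f g] by auto
next
  case (Suc k)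
  show ?case unfolding Ck_on.simps
  proof (intro conjI ballI allI)
    fix x assume "x \<in> S"
    then show "g differentiable at x"
      using frechet_derivative_cong_open(1)[OF assms(1), of x f g] Suc.prems by auto
  next
    fix u
    show "Ck_on k S (\<lambda>x. frechet_derivative g (at x) u)"
    proof (rule Suc.IH)
      show "Ck_on k S (\<lambda>x. frechet_derivative f (at x) u)" using Suc.prems by simp
      show "frechet_derivative f (at z) u = frechet_derivative g (at z) u" if "z \<in> S" for z
        using frechet_derivative_cong_open(2)[OF assms(1) that Suc.prems(1)] Suc.prems(2) that
        by auto
    qed
  qed
qed

lemma Ck_on_subset: "Ck_on k S f \<Longrightarrow> T \<subseteq> S \<Longrightarrow> Ck_on k T f"
  by (induction k arbitrary: f) (auto intro: continuous_on_subset)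

lemma Ck_on_local:
  assumes "\<And>x. x \<in> S \<Longrightarrow> \<exists>T. open T \<and> x \<in> T \<and> Ck_on k T f"
  shows "Ck_on k S f"
  using assms
proof (induction k arbitrary: f)
  case 0
  then show ?case
    unfolding Ck_on.simps
    by (intro continuous_at_imp_continuous_on ballI)
      (use continuous_on_eq_continuous_at in blast)
next
  case (Suc k)
  show ?case unfolding Ck_on.simps
  proof (intro conjI ballI allI)
    show "f differentiable at x" if "x \<in> S" for x using Suc.prems[OF that] by auto
    show "Ck_on k S (\<lambda>x. frechet_derivative f (at x) u)" for u
    proof (rule Suc.IH)
      show "\<exists>T. open T \<and> x \<in> T \<and> Ck_on k T (\<lambda>x. frechet_derivative f (at x) u)"
        if "x \<in> S" for x
        using Suc.prems[OF that] by auto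
    qed
  qed
qed

text \<open>\<open>Ck_on\<close> puts the lower order on the derivatives and not on the function
  itself, so even lowering the order is an induction; it bottoms out in differentiable implies
  continuous.\<close>

lemma Ck_on_Suc_imp: "Ck_on (Suc k) S f \<Longrightarrow> Ck_on k S f"
proof (induction k arbitrary: f)
  case 0
  then show ?case
    by (auto intro!: continuous_at_imp_continuous_on differentiable_imp_continuous_within)
next
  case (Suc k)
  from Suc.prems have "\<And>u. Ck_on (Suc k) S (\<lambda>x. frechet_derivative f (at x) u)"
    unfolding Ck_on.simps(2)[of "Suc k"] by blast
  with Suc.prems show ?case
    unfolding Ck_on.simps(2)[of "Suc k"] Ck_on.simps(2)[of k S f] by (blast intro: Suc.IH)
qed

text \<open>Lets an explicit derivative formula stand in for the choice operator
  \<open>frechet_derivative\<close>; the closure lemmas below amount to naming that formula.\<close>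

lemma Ck_on_SucI:
  assumes "open S" "\<And>x. x \<in> S \<Longrightarrow> (f has_derivative f' x) (at x)"
    and "\<And>u. Ck_on k S (\<lambda>x. f' x u)"
  shows "Ck_on (Suc k) S f"
  unfolding Ck_on.simps
proof (intro conjI ballI allI)
  show "f differentiable at x" if "x \<in> S" for x using assms(2)[OF that] differentiableI by blast
  show "Ck_on k S (\<lambda>x. frechet_derivative f (at x) u)" for u
    using frechet_derivative_at[OF assms(2)] by (intro Ck_on_cong[OF assms(1) _ assms(3)[of u]]) simp
qed

lemma Ck_on_SucD:
  assumes "Ck_on (Suc k) S f" "x \<in> S"
  shows "(f has_derivative frechet_derivative f (at x)) (at x)"
  using assms by (auto simp flip: frechet_derivative_works)

lemma Ck_on_const: "Ck_on k S (\<lambda>_. c)"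
  by (induction k arbitrary: c) auto

lemma Ck_on_add:
  assumes "open S" "Ck_on k S f" "Ck_on k S g"
  shows "Ck_on k S (\<lambda>x. f x + g x)"
  using assms(2,3)
proof (induction k arbitrary: f g)
  case 0
  then show ?case by (auto intro: continuous_on_add)
next
  case (Suc k)
  show ?case
    using Suc
    by (intro Ck_on_SucI[OF assms(1), where f' = "\<lambda>x u. frechet_derivative f (at x) u
          + frechet_derivative g (at x) u"] has_derivative_add Ck_on_SucD) auto
qed

lemma Ck_on_inner_left:
  assumes "open S" "Ck_on k S f"
  shows "Ck_on k S (\<lambda>x. f x \<bullet> b)"
  using assms(2)
proof (induction k arbitrary: f)
  case 0
  then show ?case by (auto intro: continuous_intros)
next
  case (Suc k)
  show ?case
    using Suc
    by (intro Ck_on_SucI[OF assms(1), where f' = "\<lambda>x u. frechet_derivative f (at x) u \<bullet> b"]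
        has_derivative_inner_left Ck_on_SucD) auto
qed

text \<open>Each Leibniz summand keeps one factor undifferentiated, and the order of that factor is
  lowered with \<open>Ck_on_Suc_imp\<close> before the induction hypothesis applies.\<close>

lemma Ck_on_mult:
  fixes f g :: "'e::euclidean_space \<Rightarrow> real"
  assumes "open S" "Ck_on k S f" "Ck_on k S g"
  shows "Ck_on k S (\<lambda>x. f x * g x)"
  using assms(2,3)
proof (induction k arbitrary: f g)
  case 0
  then show ?case by (auto intro: continuous_on_mult)
next
  case (Suc k)
  show ?case
  proof (rule Ck_on_SucI[OF assms(1)])
    show "((\<lambda>x. f x * g x) has_derivative (\<lambda>u. f x * frechet_derivative g (at x) u
        + frechet_derivative f (at x) u * g x)) (at x)" if "x \<in> S" for x
      using Suc.prems that by (intro has_derivative_mult Ck_on_SucD)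
    show "Ck_on k S (\<lambda>x. f x * frechet_derivative g (at x) u
        + frechet_derivative f (at x) u * g x)" for u
      using Suc.prems Ck_on_Suc_imp[OF Suc.prems(1)] Ck_on_Suc_imp[OF Suc.prems(2)]
      by (intro Ck_on_add[OF assms(1)] Suc.IH) auto
  qed
qed

text \<open>The derivative -f'/f^2 contains 1/f again, so the induction hypothesis for the same
  \<open>f\<close> suffices; the exponential below works alike.\<close>

lemma Ck_on_inverse:
  fixes f :: "'e::euclidean_space \<Rightarrow> real"
  assumes "open S" "Ck_on k S f" "\<And>x. x \<in> S \<Longrightarrow> f x \<noteq> 0"
  shows "Ck_on k S (\<lambda>x. inverse (f x))"
  using assms(2,3)
proof (induction k)
  case 0
  then show ?case by (auto intro: continuous_on_inverse)
next
  case (Suc k)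
  note I = Suc.IH[OF Ck_on_Suc_imp[OF Suc.prems(1)] Suc.prems(2)]
  show ?case
  proof (rule Ck_on_SucI[OF assms(1)])
    show "((\<lambda>x. inverse (f x)) has_derivative
        (\<lambda>u. -1 * (inverse (f x) * frechet_derivative f (at x) u * inverse (f x)))) (at x)"
      if "x \<in> S" for x
      using Deriv.has_derivative_inverse[OF Suc.prems(2)[OF that] Ck_on_SucD[OF Suc.prems(1) that]]
      by simp
    show "Ck_on k S (\<lambda>x. -1 * (inverse (f x) * frechet_derivative f (at x) u * inverse (f x)))" for u
      using Suc.prems I by (intro Ck_on_mult[OF assms(1)] Ck_on_const) auto
  qed
qed

lemma Ck_on_exp:
  fixes f :: "'e::euclidean_space \<Rightarrow> real"
  assumes "open S" "Ck_on k S f"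
  shows "Ck_on k S (\<lambda>x. exp (f x))"
  using assms(2)
proof (induction k)
  case 0
  then show ?case by (auto intro: continuous_on_exp)
next
  case (Suc k)
  note I = Suc.IH[OF Ck_on_Suc_imp[OF Suc.prems(1)]]
  show ?case
  proof (rule Ck_on_SucI[OF assms(1)])
    show "((\<lambda>x. exp (f x)) has_derivative
        (\<lambda>u. exp (f x) * frechet_derivative f (at x) u)) (at x)"
      if "x \<in> S" for x
      using Ck_on_SucD[OF Suc.prems(1) that] by (auto intro!: derivative_eq_intros)
    show "Ck_on k S (\<lambda>x. exp (f x) * frechet_derivative f (at x) u)" for u
      using Suc.prems I by (intro Ck_on_mult[OF assms(1)]) auto
  qed
qed

lemma Ck_on_sum:
  fixes f :: "'i \<Rightarrow> 'e::euclidean_space \<Rightarrow> 'f::real_normed_vector"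
  assumes "open S" "finite I" "\<And>i. i \<in> I \<Longrightarrow> Ck_on k S (f i)"
  shows "Ck_on k S (\<lambda>x. \<Sum>i\<in>I. f i x)"
  using assms(2,3)
proof (induction I)
  case (insert i I)
  then have "Ck_on k S (\<lambda>x. f i x + (\<Sum>i\<in>I. f i x))"
    by (intro Ck_on_add[OF assms(1)]) auto
  with insert show ?case by simp
qed (simp add: Ck_on_const)

text \<open>The recursion in \<open>Ck_on\<close> differentiates in fixed directions, whereas the
  chain rule evaluates the derivative of \<open>f\<close> in the moving direction dg(u). Expanding
  that direction in a basis leaves only products of real functions.\<close>

lemma frechet_derivative_compose_basis:
  fixes f :: "'e::euclidean_space \<Rightarrow> real" and g :: "'d::euclidean_space \<Rightarrow> 'e"
  assumes f: "f differentiable (at (g x))" and g: "g differentiable (at x)"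
  shows "((\<lambda>x. f (g x)) has_derivative
    (\<lambda>u. \<Sum>b\<in>Basis. (frechet_derivative g (at x) u \<bullet> b) * frechet_derivative f (at (g x)) b)) (at x)"
proof -
  note F = iffD1[OF frechet_derivative_works f] and G = iffD1[OF frechet_derivative_works g]
  have F': "frechet_derivative f (at (g x)) v
      = (\<Sum>b\<in>Basis. (v \<bullet> b) * frechet_derivative f (at (g x)) b)" for v
  proof -
    have "frechet_derivative f (at (g x)) (\<Sum>b\<in>Basis. (v \<bullet> b) *\<^sub>R b)
        = (\<Sum>b\<in>Basis. (v \<bullet> b) * frechet_derivative f (at (g x)) b)"
      using has_derivative_linear[OF F] by (simp add: linear_sum linear_cmul)
    then show ?thesis
      by (simp only: euclidean_representation)
  qed
  show ?thesis
    by (rule has_derivative_eq_rhs[OF has_derivative_compose[OF G F]]) (rule ext, rule F')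
qed

lemma Ck_on_compose:
  fixes f :: "'e::euclidean_space \<Rightarrow> real" and g :: "'d::euclidean_space \<Rightarrow> 'e"
  assumes "open S" "Ck_on k T f" "Ck_on k S g" "g ` S \<subseteq> T"
  shows "Ck_on k S (\<lambda>x. f (g x))"
  using assms(2,3)
proof (induction k arbitrary: f)
  case 0
  then show ?case using assms(4) by (auto intro: continuous_on_compose2)
next
  case (Suc k)
  show ?case
  proof (rule Ck_on_SucI[OF assms(1)])
    show "((\<lambda>x. f (g x)) has_derivative
        (\<lambda>u. \<Sum>b\<in>Basis. (frechet_derivative g (at x) u \<bullet> b) * frechet_derivative f (at (g x)) b))
        (at x)" if "x \<in> S" for x
      using Suc.prems that assms(4) by (intro frechet_derivative_compose_basis) auto
    show "Ck_on k S (\<lambda>x. \<Sum>b\<in>Basis. (frechet_derivative g (at x) u \<bullet> b)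
        * frechet_derivative f (at (g x)) b)" for u
    proof (intro Ck_on_sum Ck_on_mult Ck_on_inner_left assms(1) finite_Basis)
      show "Ck_on k S (\<lambda>x. frechet_derivative g (at x) u)" using Suc.prems(2) by simp
      show "Ck_on k S (\<lambda>x. frechet_derivative f (at (g x)) b)" for b
        using Suc.prems(1) Ck_on_Suc_imp[OF Suc.prems(2)]
        by (intro Suc.IH[where f = "\<lambda>z. frechet_derivative f (at z) b"]) auto
    qed
  qed
qed

section \<open>Closure properties of smooth maps, from all orders at once\<close>

lemma smooth_on_cong: "open S \<Longrightarrow> (\<And>z. z \<in> S \<Longrightarrow> f z = g z) \<Longrightarrow> smooth_on S f \<Longrightarrow> smooth_on S g"
  unfolding smooth_on_def using Ck_on_cong by blast

lemma smooth_on_subset: "smooth_on S f \<Longrightarrow> T \<subseteq> S \<Longrightarrow> smooth_on T f"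
  unfolding smooth_on_def using Ck_on_subset by blast

lemma smooth_on_local:
  assumes "\<And>x. x \<in> S \<Longrightarrow> \<exists>T. open T \<and> x \<in> T \<and> smooth_on T f"
  shows "smooth_on S f"
  unfolding smooth_on_def
proof (intro allI Ck_on_local)
  show "\<exists>T. open T \<and> x \<in> T \<and> Ck_on k T f" if "x \<in> S" for x k
    using assms[OF that] unfolding smooth_on_def by blast
qed

lemma smooth_on_const: "smooth_on S (\<lambda>_. c)"
  by (simp add: smooth_on_def Ck_on_const)

lemma smooth_on_add: "open S \<Longrightarrow> smooth_on S f \<Longrightarrow> smooth_on S g \<Longrightarrow> smooth_on S (\<lambda>x. f x + g x)"
  by (simp add: smooth_on_def Ck_on_add)

lemma smooth_on_mult:
  fixes f g :: "'e::euclidean_space \<Rightarrow> real"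
  shows "open S \<Longrightarrow> smooth_on S f \<Longrightarrow> smooth_on S g \<Longrightarrow> smooth_on S (\<lambda>x. f x * g x)"
  by (simp add: smooth_on_def Ck_on_mult)

lemma smooth_on_sum:
  fixes f :: "'i \<Rightarrow> 'e::euclidean_space \<Rightarrow> 'f::real_normed_vector"
  shows "open S \<Longrightarrow> finite I \<Longrightarrow> (\<And>i. i \<in> I \<Longrightarrow> smooth_on S (f i)) \<Longrightarrow> smooth_on S (\<lambda>x. \<Sum>i\<in>I. f i x)"
  by (simp add: smooth_on_def Ck_on_sum)

lemma smooth_on_inverse:
  fixes f :: "'e::euclidean_space \<Rightarrow> real"
  shows "open S \<Longrightarrow> smooth_on S f \<Longrightarrow> (\<And>x. x \<in> S \<Longrightarrow> f x \<noteq> 0) \<Longrightarrow> smooth_on S (\<lambda>x. inverse (f x))"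
  by (simp add: smooth_on_def Ck_on_inverse)

lemma smooth_on_exp:
  fixes f :: "'e::euclidean_space \<Rightarrow> real"
  shows "open S \<Longrightarrow> smooth_on S f \<Longrightarrow> smooth_on S (\<lambda>x. exp (f x))"
  by (simp add: smooth_on_def Ck_on_exp)

lemma smooth_on_compose:
  fixes f :: "'e::euclidean_space \<Rightarrow> real" and g :: "'d::euclidean_space \<Rightarrow> 'e"
  shows "open S \<Longrightarrow> smooth_on T f \<Longrightarrow> smooth_on S g \<Longrightarrow> g ` S \<subseteq> T \<Longrightarrow> smooth_on S (\<lambda>x. f (g x))"
  unfolding smooth_on_def by (blast intro: Ck_on_compose)

lemma smooth_on_differentiable: "smooth_on S f \<Longrightarrow> x \<in> S \<Longrightarrow> f differentiable (at x)"
  using Ck_on.simps(2)[of 0 S f] unfolding smooth_on_def by blast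

lemma smooth_on_frechet_derivative:
  "smooth_on S f \<Longrightarrow> smooth_on S (\<lambda>x. frechet_derivative f (at x) u)"
  unfolding smooth_on_def using Ck_on.simps(2)[of _ S f] by blast

lemma smooth_on_inner: "smooth_on S (\<lambda>x::'e::euclidean_space. x \<bullet> b)"
proof -
  have "Ck_on k UNIV (\<lambda>x::'e. x \<bullet> b)" for k
  proof (cases k)
    case (Suc n)
    show ?thesis unfolding Suc
      by (rule Ck_on_SucI[where f' = "\<lambda>_ u. u \<bullet> b"])
        (auto intro!: derivative_eq_intros Ck_on_const)
  qed (auto intro: continuous_intros)
  then show ?thesis by (auto simp: smooth_on_def intro: Ck_on_subset)
qed

section \<open>Bump functions\<close>

text \<open>The family is closed under differentiation: the derivative of the \<open>n\<close>-th member is the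
  \<open>(n+2)\<close>-nd minus \<open>n\<close> times the \<open>(n+1)\<close>-st.\<close>

definition flat :: "nat \<Rightarrow> real \<Rightarrow> real" where
  "flat n t = (if t > 0 then inverse t ^ n * exp (- inverse t) else 0)"

lemma flat_DERIV: "(flat n has_real_derivative (flat (n + 2) t - real n * flat (n + 1) t)) (at t)"
proof -
  consider "t > 0" | "t < 0" | "t = 0" by linarith
  then show ?thesis
  proof cases
    case 1
    \<comment> \<open>At n = 0 the truncated exponent \<open>n - Suc 0\<close> would spoil the
      identity, but the factor \<open>real n\<close> is then 0.\<close>
    have P: "real n * (inverse t ^ (n - Suc 0) * inverse t) = real n * inverse t ^ n"
      by (cases n) auto
    have "((\<lambda>t. inverse t ^ n) has_real_derivative
        real n * (- (inverse t ^ Suc (Suc 0)) * inverse t ^ (n - Suc 0))) (at t)"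
      using 1 DERIV_inverse[of t] by (intro DERIV_power) auto
    then have "((\<lambda>t. inverse t ^ n) has_real_derivative - (real n * inverse t ^ n * inverse t)) (at t)"
      by (simp add: P[symmetric] algebra_simps)
    moreover have "((\<lambda>t. exp (- inverse t)) has_real_derivative
        inverse t ^ 2 * exp (- inverse t)) (at t)"
      using 1 by (auto intro!: derivative_eq_intros simp: power2_eq_square)
    ultimately have "((\<lambda>t. inverse t ^ n * exp (- inverse t)) has_real_derivative
        - (real n * inverse t ^ n * inverse t) * exp (- inverse t)
        + inverse t ^ 2 * exp (- inverse t) * inverse t ^ n) (at t)"
      by (rule DERIV_mult)
    then have "((\<lambda>t. inverse t ^ n * exp (- inverse t)) has_real_derivative
        (flat (n + 2) t - real n * flat (n + 1) t)) (at t)"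
      using 1 by (simp add: flat_def algebra_simps power2_eq_square)
    then show ?thesis
      by (rule has_field_derivative_transform_within_open[of _ _ _ "{0<..}"])
        (use 1 in \<open>auto simp: flat_def\<close>)
  next
    case 2
    have "((\<lambda>t. 0) has_real_derivative (flat (n + 2) t - real n * flat (n + 1) t)) (at t)"
      using 2 by (auto simp: flat_def)
    then show ?thesis
      by (rule has_field_derivative_transform_within_open[of _ _ _ "{..<0}"])
        (use 2 in \<open>auto simp: flat_def\<close>)
  next
    case 3
    \<comment> \<open>At the origin both one-sided difference quotients tend to 0: on the right the
      exponential beats every power of 1/h, on the left the quotient is identically 0.\<close>
    have R: "((\<lambda>h. inverse h ^ n * exp (- inverse h) / h) \<longlongrightarrow> 0) (at_right (0::real))"
      by real_asymp
    have "((\<lambda>h. flat n h / h) \<longlongrightarrow> 0) (at_right 0)"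
      by (rule Lim_transform_eventually[OF R])
        (auto simp: flat_def eventually_at_filter)
    moreover have "((\<lambda>h. flat n h / h) \<longlongrightarrow> 0) (at_left 0)"
      by (rule Lim_transform_eventually[OF tendsto_const])
        (auto simp: flat_def eventually_at_filter)
    ultimately have "((\<lambda>h. flat n h / h) \<longlongrightarrow> 0) (at 0)"
      by (rule filterlim_split_at[rotated])
    then show ?thesis using 3 by (auto simp: DERIV_def flat_def)
  qed
qed

lemma smooth_on_flat: "smooth_on UNIV (flat n)"
proof -
  have "Ck_on k UNIV (flat n)" for k
  proof (induction k arbitrary: n)
    case 0
    then show ?case
      by (auto intro!: continuous_at_imp_continuous_on DERIV_isCont[OF flat_DERIV])
  next
    case (Suc k)
    show ?case
    proof (rule Ck_on_SucI)
      show "(flat n has_derivative (\<lambda>u. (flat (n + 2) t + (- real n) * flat (n + 1) t) * u)) (at t)" for t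
        using flat_DERIV[of n t] by (simp add: has_field_derivative_def)
      show "Ck_on k UNIV (\<lambda>t. (flat (n + 2) t + (- real n) * flat (n + 1) t) * u)" for u
        by (intro Ck_on_mult Ck_on_add Ck_on_const Suc.IH open_UNIV)
    qed auto
  qed
  then show ?thesis by (simp add: smooth_on_def)
qed

text \<open>The bump is a/(a + b) with a positive exactly inside radius r and b positive exactly
  outside radius r/2; since r/2 < r, the denominator never vanishes.\<close>

lemma smooth_bump:
  fixes c :: "'e::euclidean_space"
  assumes "0 < r"
  obtains \<beta> :: "'e \<Rightarrow> real" where "smooth_on UNIV \<beta>"
    "\<And>z. dist c z \<le> r / 2 \<Longrightarrow> \<beta> z = 1" "\<And>z. r \<le> dist c z \<Longrightarrow> \<beta> z = 0"
proof -
  \<comment> \<open>The squared distance, which unlike the distance is smooth at the centre, written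
    with sums and products so that the closure lemmas apply.\<close>
  define N where "N z = (\<Sum>b\<in>Basis. (z \<bullet> b + - (c \<bullet> b)) * (z \<bullet> b + - (c \<bullet> b)))" for z
  have N: "N z = (dist c z)\<^sup>2" for z
  proof -
    have "(dist c z)\<^sup>2 = (z - c) \<bullet> (z - c)"
      by (simp add: dist_commute[of c z] dist_norm[of z c] flip: power2_norm_eq_inner)
    then show ?thesis
      unfolding euclidean_inner[of "z - c" "z - c"] by (simp add: N_def inner_diff_left)
  qed
  have sN: "smooth_on UNIV N"
    unfolding N_def
    by (intro smooth_on_sum smooth_on_mult smooth_on_add smooth_on_const smooth_on_inner) auto
  have s1: "smooth_on UNIV (\<lambda>z. flat 0 (r\<^sup>2 + (-1) * N z))"
    by (rule smooth_on_compose[OF open_UNIV smooth_on_flat smooth_on_add])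
      (simp_all only: smooth_on_mult smooth_on_const sN open_UNIV subset_UNIV)
  have s2: "smooth_on UNIV (\<lambda>z. flat 0 (N z + (- (r/2)\<^sup>2)))"
    by (rule smooth_on_compose[OF open_UNIV smooth_on_flat smooth_on_add])
      (simp_all only: smooth_on_mult smooth_on_const sN open_UNIV subset_UNIV)
  define \<beta> where "\<beta> z = flat 0 (r\<^sup>2 + (-1) * N z)
    * inverse (flat 0 (r\<^sup>2 + (-1) * N z) + flat 0 (N z + (- (r/2)\<^sup>2)))" for z
  have nn: "flat 0 t \<ge> 0" and pos: "t > 0 \<Longrightarrow> flat 0 t > 0" for t
    by (auto simp: flat_def)
  have r: "(r/2)\<^sup>2 < r\<^sup>2" using assms by (simp add: power2_eq_square)
  have ne: "flat 0 (r\<^sup>2 + (-1) * N z) + flat 0 (N z + (- (r/2)\<^sup>2)) \<noteq> 0" for z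
  proof (cases "N z < r\<^sup>2")
    case True
    then show ?thesis using pos[of "r\<^sup>2 + (-1) * N z"] nn[of "N z + (- (r/2)\<^sup>2)"] by simp
  next
    case False
    then show ?thesis using pos[of "N z + (- (r/2)\<^sup>2)"] nn[of "r\<^sup>2 + (-1) * N z"] r by simp
  qed
  have "smooth_on UNIV \<beta>"
    unfolding \<beta>_def
    by (intro smooth_on_mult smooth_on_inverse smooth_on_add s1 s2 open_UNIV) (rule ne)
  moreover have "\<beta> z = 1" if "dist c z \<le> r / 2" for z
  proof -
    have "N z \<le> (r/2)\<^sup>2" using that by (simp add: N power_mono)
    then have "flat 0 (N z + (- (r/2)\<^sup>2)) = 0" by (simp add: flat_def)
    then show ?thesis using ne[of z] by (simp add: \<beta>_def)
  qed
  moreover have "\<beta> z = 0" if "r \<le> dist c z" for z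
  proof -
    have "N z \<ge> r\<^sup>2" using that assms by (simp add: N power_mono)
    then show ?thesis by (simp add: \<beta>_def flat_def)
  qed
  ultimately show ?thesis by (rule that)
qed

section \<open>Smooth functions on a manifold\<close>

text \<open>Unlike global smoothness, this germ-wise notion is closed under division by a function that
  does not vanish at the point, as needed to solve linear systems.\<close>

definition smooth_at ::
  "('a::{t2_space,second_countable_topology}, 'e::euclidean_space) atlas \<Rightarrow> 'a \<Rightarrow> ('a \<Rightarrow> real) \<Rightarrow> bool"
where
  "smooth_at A p f \<longleftrightarrow>
     (\<exists>N. open N \<and> p \<in> N \<and> (\<forall>(U, x)\<in>A. smooth_on (x ` (U \<inter> N)) (f \<circ> inv_into U x)))"

lemma sum_fun_apply: "(\<Sum>i\<in>I. F i) f = (\<Sum>i\<in>I. F i f)"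
  by (induction I rule: infinite_finite_induct) auto

locale manifold =
  fixes A :: "('a::{t2_space,second_countable_topology}, 'e::euclidean_space) atlas"
  assumes smooth_manifold: "smooth_manifold A"
begin

lemma chart_at: obtains U x where "(U, x) \<in> A" "p \<in> U"
proof -
  have "p \<in> (\<Union>(U, x)\<in>A. U)" using smooth_manifold by (simp add: smooth_manifold_def)
  then show ?thesis using that by auto
qed

lemma chart_homeomorphism:
  assumes "(U, x) \<in> A"
  shows "open U" "open (x ` U)" "homeomorphism U (x ` U) x (inv_into U x)"
  using assms smooth_manifold unfolding smooth_manifold_def by blast+

lemma chart_inv:
  assumes "(U, x) \<in> A" "p \<in> U"
  shows "inv_into U x (x p) = p"
  using homeomorphism_apply1[OF chart_homeomorphism(3)[OF assms(1)] assms(2)] .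

lemma chart_open_image:
  assumes "(U, x) \<in> A" "open N"
  shows "open (x ` (U \<inter> N))"
proof -
  have "openin (top_of_set U) (U \<inter> N)" using assms(2) by (rule openin_open_Int)
  with chart_homeomorphism(3)[OF assms(1)] have "openin (top_of_set (x ` U)) (x ` (U \<inter> N))"
    by (rule homeomorphism_imp_open_map)
  then show ?thesis using chart_homeomorphism(2)[OF assms(1)] openin_open_eq by blast
qed

lemma chart_open_vimage:
  assumes "(U, x) \<in> A" "open S"
  shows "open (U \<inter> x -` S)"
  using homeomorphism_cont1[OF chart_homeomorphism(3)[OF assms(1)]] chart_homeomorphism(1)[OF assms(1)]
    assms(2)
  by (rule continuous_open_preimage)

lemma transition_smooth:
  assumes "(U, x) \<in> A" "(V, y) \<in> A"
  shows "smooth_on (x ` (U \<inter> V)) (y \<circ> inv_into U x)"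
  using assms smooth_manifold unfolding smooth_manifold_def by blast

lemma smooth_fun_imp_smooth_at: "smooth_fun A f \<Longrightarrow> smooth_at A p f"
  unfolding smooth_fun_def smooth_at_def by (intro exI[of _ UNIV]) auto

lemma smooth_fun_chart:
  "smooth_fun A f \<Longrightarrow> (U, x) \<in> A \<Longrightarrow> smooth_on (x ` U) (f \<circ> inv_into U x)"
  unfolding smooth_fun_def by blast

text \<open>The neighbourhoods furnished by \<open>smooth_at\<close> vary with the point; locality
  of smoothness glues them within each chart.\<close>

lemma smooth_funI:
  assumes "\<And>p. smooth_at A p f"
  shows "smooth_fun A f"
  unfolding smooth_fun_def
proof clarify
  fix U x assume Ux: "(U, x) \<in> A"
  show "smooth_on (x ` U) (f \<circ> inv_into U x)"
  proof (rule smooth_on_local)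
    fix z assume "z \<in> x ` U"
    then obtain p where p: "p \<in> U" "z = x p" by auto
    obtain N where N: "open N" "p \<in> N" "\<forall>(U, x)\<in>A. smooth_on (x ` (U \<inter> N)) (f \<circ> inv_into U x)"
      using assms[of p] unfolding smooth_at_def by blast
    then show "\<exists>T. open T \<and> z \<in> T \<and> smooth_on T (f \<circ> inv_into U x)"
      using Ux p chart_open_image[OF Ux N(1)] by (intro exI[of _ "x ` (U \<inter> N)"]) auto
  qed
qed

lemma smooth_at_cong:
  assumes "open N" "p \<in> N" "\<And>q. q \<in> N \<Longrightarrow> f q = h q" "smooth_at A p f"
  shows "smooth_at A p h"
proof -
  obtain M where M: "open M" "p \<in> M" "\<And>U x. (U, x) \<in> A \<Longrightarrow> smooth_on (x ` (U \<inter> M)) (f \<circ> inv_into U x)"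
    using assms(4) unfolding smooth_at_def by blast
  have "smooth_on (x ` (U \<inter> (M \<inter> N))) (h \<circ> inv_into U x)" if Ux: "(U, x) \<in> A" for U x
  proof (rule smooth_on_cong[OF chart_open_image[OF Ux open_Int[OF M(1) assms(1)]]])
    show "smooth_on (x ` (U \<inter> (M \<inter> N))) (f \<circ> inv_into U x)"
      using M(3)[OF Ux] by (rule smooth_on_subset) auto
  qed (auto simp: chart_inv[OF Ux] assms(3))
  with M assms(1,2) show ?thesis unfolding smooth_at_def by (intro exI[of _ "M \<inter> N"]) auto
qed

text \<open>Handles the shrinking to a common neighbourhood once for sums, products and, with one
  argument ignored, the exponential. Reciprocals are separate because their domain must shrink
  further, to where the function is nonzero.\<close>

lemma smooth_at_binary:
  assumes F: "\<And>(S::'e set) a b. open S \<Longrightarrow> smooth_on S a \<Longrightarrow> smooth_on S b \<Longrightarrow> smooth_on S (\<lambda>z. F (a z) (b z))"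
    and "smooth_at A p f" "smooth_at A p h"
  shows "smooth_at A p (\<lambda>q. F (f q) (h q))"
proof -
  obtain M where M: "open M" "p \<in> M" "\<And>U x. (U, x) \<in> A \<Longrightarrow> smooth_on (x ` (U \<inter> M)) (f \<circ> inv_into U x)"
    using assms(2) unfolding smooth_at_def by blast
  obtain N where N: "open N" "p \<in> N" "\<And>U x. (U, x) \<in> A \<Longrightarrow> smooth_on (x ` (U \<inter> N)) (h \<circ> inv_into U x)"
    using assms(3) unfolding smooth_at_def by blast
  have "smooth_on (x ` (U \<inter> (M \<inter> N))) ((\<lambda>q. F (f q) (h q)) \<circ> inv_into U x)" if Ux: "(U, x) \<in> A" for U x
  proof -
    have "smooth_on (x ` (U \<inter> (M \<inter> N))) (\<lambda>z. F ((f \<circ> inv_into U x) z) ((h \<circ> inv_into U x) z))"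
      by (intro F chart_open_image[OF Ux open_Int[OF M(1) N(1)]]
          smooth_on_subset[OF M(3)[OF Ux]] smooth_on_subset[OF N(3)[OF Ux]]) auto
    then show ?thesis by (simp add: o_def)
  qed
  with M N show ?thesis unfolding smooth_at_def by (intro exI[of _ "M \<inter> N"]) auto
qed

lemma smooth_at_const: "smooth_at A p (\<lambda>_. c)"
  unfolding smooth_at_def o_def by (intro exI[of _ UNIV]) (auto simp: smooth_on_const)

lemma smooth_at_add: "smooth_at A p f \<Longrightarrow> smooth_at A p h \<Longrightarrow> smooth_at A p (\<lambda>q. f q + h q)"
  by (rule smooth_at_binary) (rule smooth_on_add)

lemma smooth_at_mult: "smooth_at A p f \<Longrightarrow> smooth_at A p h \<Longrightarrow> smooth_at A p (\<lambda>q. f q * h q)"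
  by (rule smooth_at_binary) (rule smooth_on_mult)

lemma smooth_at_exp:
  assumes "smooth_at A p f"
  shows "smooth_at A p (\<lambda>q. exp (f q))"
  by (rule smooth_at_binary[where F = "\<lambda>a b. exp a", OF _ assms assms]) (rule smooth_on_exp)

lemma smooth_at_diff:
  assumes "smooth_at A p f" "smooth_at A p h"
  shows "smooth_at A p (\<lambda>q. f q - h q)"
  using smooth_at_add[OF assms(1) smooth_at_mult[OF smooth_at_const[of p "-1"] assms(2)]] by simp

lemma smooth_at_sum:
  assumes "finite I" "\<And>i. i \<in> I \<Longrightarrow> smooth_at A p (f i)"
  shows "smooth_at A p (\<lambda>q. \<Sum>i\<in>I. f i q)"
  using assms
proof (induction I)
  case (insert i I)
  then have "smooth_at A p (\<lambda>q. f i q + (\<Sum>i\<in>I. f i q))"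
    by (intro smooth_at_add) auto
  with insert show ?case by simp
qed (simp add: smooth_at_const)

text \<open>Supplies the neighbourhoods on which a denominator or a pivot stays nonzero.\<close>

lemma smooth_at_isCont:
  assumes "smooth_at A p f"
  shows "isCont f p"
proof -
  obtain M where M: "open M" "p \<in> M" "\<And>U x. (U, x) \<in> A \<Longrightarrow> smooth_on (x ` (U \<inter> M)) (f \<circ> inv_into U x)"
    using assms unfolding smooth_at_def by blast
  obtain U x where Ux: "(U, x) \<in> A" and p: "p \<in> U" by (rule chart_at)
  have "continuous_on (x ` (U \<inter> M)) (f \<circ> inv_into U x)"
    using M(3)[OF Ux] Ck_on.simps(1) unfolding smooth_on_def by blast
  moreover have "continuous_on (U \<inter> M) x"
    using homeomorphism_cont1[OF chart_homeomorphism(3)[OF Ux]] by (rule continuous_on_subset) auto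
  ultimately have "continuous_on (U \<inter> M) ((f \<circ> inv_into U x) \<circ> x)"
    by (rule continuous_on_compose[rotated])
  then have "continuous_on (U \<inter> M) f"
    by (rule continuous_on_eq) (auto simp: chart_inv[OF Ux])
  then show ?thesis
    using p M chart_homeomorphism(1)[OF Ux] continuous_on_eq_continuous_at open_Int by blast
qed

lemma smooth_at_inverse:
  assumes "smooth_at A p f" "f p \<noteq> 0"
  shows "smooth_at A p (\<lambda>q. inverse (f q))"
proof -
  obtain M where M: "open M" "p \<in> M" "\<And>U x. (U, x) \<in> A \<Longrightarrow> smooth_on (x ` (U \<inter> M)) (f \<circ> inv_into U x)"
    using assms(1) unfolding smooth_at_def by blast
  obtain L where L: "open L" "p \<in> L" "\<And>q. q \<in> L \<Longrightarrow> f q \<noteq> 0"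
    using smooth_at_isCont[OF assms(1)] assms(2)
    unfolding continuous_at_open by (elim allE[of _ "- {0}"]) auto
  have "smooth_on (x ` (U \<inter> (M \<inter> L))) ((\<lambda>q. inverse (f q)) \<circ> inv_into U x)" if Ux: "(U, x) \<in> A" for U x
  proof -
    have "smooth_on (x ` (U \<inter> (M \<inter> L))) (\<lambda>z. inverse ((f \<circ> inv_into U x) z))"
    proof (rule smooth_on_inverse)
      show "smooth_on (x ` (U \<inter> (M \<inter> L))) (f \<circ> inv_into U x)"
        using M(3)[OF Ux] by (rule smooth_on_subset) auto
    qed (use chart_open_image[OF Ux open_Int[OF M(1) L(1)]] L(3) in \<open>auto simp: chart_inv[OF Ux]\<close>)
    then show ?thesis by (simp add: o_def)
  qed
  with M L show ?thesis unfolding smooth_at_def by (intro exI[of _ "M \<inter> L"]) auto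
qed

text \<open>One chart suffices: read in any other chart, the function is \<open>F\<close> after a
  transition map.\<close>

lemma smooth_at_chart:
  assumes Ux: "(U, x) \<in> A" and p: "p \<in> U" and S: "open S" "x p \<in> S" "smooth_on S F"
  shows "smooth_at A p (\<lambda>q. F (x q))"
proof -
  let ?N = "U \<inter> x -` S"
  have N: "open ?N" by (rule chart_open_vimage[OF Ux S(1)])
  have "smooth_on (y ` (V \<inter> ?N)) ((\<lambda>q. F (x q)) \<circ> inv_into V y)" if Vy: "(V, y) \<in> A" for V y
  proof -
    have "smooth_on (y ` (V \<inter> ?N)) (\<lambda>z. F ((x \<circ> inv_into V y) z))"
    proof (rule smooth_on_compose[OF chart_open_image[OF Vy N] S(3)])
      show "smooth_on (y ` (V \<inter> ?N)) (x \<circ> inv_into V y)"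
        using transition_smooth[OF Vy Ux] by (rule smooth_on_subset) auto
    qed (auto simp: chart_inv[OF Vy])
    then show ?thesis by (simp add: o_def)
  qed
  with N p S(2) show ?thesis unfolding smooth_at_def by (intro exI[of _ ?N]) auto
qed

lemma smooth_fun_mult: "smooth_fun A f \<Longrightarrow> smooth_fun A h \<Longrightarrow> smooth_fun A (\<lambda>q. f q * h q)"
  by (rule smooth_funI) (rule smooth_at_mult[OF smooth_fun_imp_smooth_at smooth_fun_imp_smooth_at])

lemma smooth_fun_add: "smooth_fun A f \<Longrightarrow> smooth_fun A h \<Longrightarrow> smooth_fun A (\<lambda>q. f q + h q)"
  by (rule smooth_funI) (rule smooth_at_add[OF smooth_fun_imp_smooth_at smooth_fun_imp_smooth_at])

lemma smooth_fun_diff: "smooth_fun A f \<Longrightarrow> smooth_fun A h \<Longrightarrow> smooth_fun A (\<lambda>q. f q - h q)"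
  by (rule smooth_funI) (rule smooth_at_diff[OF smooth_fun_imp_smooth_at smooth_fun_imp_smooth_at])

lemma smooth_fun_exp: "smooth_fun A f \<Longrightarrow> smooth_fun A (\<lambda>q. exp (f q))"
  by (rule smooth_funI) (rule smooth_at_exp[OF smooth_fun_imp_smooth_at])

text \<open>The bump lives on a ball in a chart and is extended by zero. The closed set
  \<open>K\<close> is recorded because products with chart expressions are later extended by zero as
  well and need the open complement of \<open>K\<close> around points outside the chart; on
  \<open>N\<close>, where the bump is 1, cutting off changes nothing.\<close>

lemma bump_fun:
  assumes "open W" "p \<in> W"
  obtains \<rho> N K where "smooth_fun A \<rho>" "open N" "p \<in> N" "N \<subseteq> K" "closed K" "K \<subseteq> W"
    "\<And>q. q \<in> N \<Longrightarrow> \<rho> q = 1" "\<And>q. q \<notin> K \<Longrightarrow> \<rho> q = 0"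
proof -
  obtain U x where Ux: "(U, x) \<in> A" and p: "p \<in> U" by (rule chart_at)
  obtain r where r: "0 < r" "cball (x p) r \<subseteq> x ` (U \<inter> W)"
    using chart_open_image[OF Ux assms(1)] p assms(2) unfolding open_contains_cball by blast
  obtain \<beta> :: "'e \<Rightarrow> real" where \<beta>: "smooth_on UNIV \<beta>" "\<And>z. dist (x p) z \<le> r / 2 \<Longrightarrow> \<beta> z = 1"
      "\<And>z. r \<le> dist (x p) z \<Longrightarrow> \<beta> z = 0"
    using smooth_bump[OF r(1), of "x p"] by blast
  define \<rho> where "\<rho> q = (if q \<in> U then \<beta> (x q) else 0)" for q
  define K where "K = inv_into U x ` cball (x p) r"
  define N where "N = U \<inter> x -` ball (x p) (r / 2)"
  have "continuous_on (cball (x p) r) (inv_into U x)"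
    using homeomorphism_cont2[OF chart_homeomorphism(3)[OF Ux]] r(2) by (auto elim!: continuous_on_subset)
  \<comment> \<open>The Hausdorff axiom enters here: a compact set is closed in the whole manifold,
    not only within the chart.\<close>
  then have K: "closed K" unfolding K_def by (intro compact_imp_closed compact_continuous_image) auto
  have KU: "K \<subseteq> U \<inter> W" unfolding K_def using r(2) chart_inv[OF Ux] by fastforce
  have inK: "q \<in> K" if "q \<in> U" "dist (x p) (x q) \<le> r" for q
    unfolding K_def using that chart_inv[OF Ux that(1)] by (intro image_eqI[of _ _ "x q"]) auto
  have 0: "\<rho> q = 0" if "q \<notin> K" for q
    using that inK[of q] \<beta>(3)[of "x q"] by (force simp: \<rho>_def)
  have "smooth_at A q \<rho>" for q
  proof (cases "q \<in> U")
    case True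
    show ?thesis
      by (rule smooth_at_cong[OF chart_homeomorphism(1)[OF Ux] True _ smooth_at_chart[OF Ux True _ _ \<beta>(1)]])
        (auto simp: \<rho>_def)
  next
    case False
    show ?thesis
      by (rule smooth_at_cong[OF open_Compl[OF K] _ _ smooth_at_const[of q 0]])
        (use False KU 0 in auto)
  qed
  then have "smooth_fun A \<rho>" by (rule smooth_funI)
  moreover have "open N" unfolding N_def by (rule chart_open_vimage[OF Ux open_ball])
  moreover have "p \<in> N" using p r(1) by (simp add: N_def)
  moreover have "N \<subseteq> K" using inK r(1) by (auto simp: N_def)
  moreover have "\<rho> q = 1" if "q \<in> N" for q using that \<beta>(2) by (auto simp: N_def \<rho>_def)
  ultimately show ?thesis using KU by (intro that[of \<rho> N K]) (auto intro: K 0)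
qed

section \<open>Tangent vectors\<close>

text \<open>Turns the function-valued \<open>coord_tvec\<close> into an honest derivative; the laws
  for tangent vectors below then follow from linearity and uniqueness of derivatives.\<close>

lemma smooth_fun_chart_derivative:
  assumes "smooth_fun A f" "(U, x) \<in> A" "p \<in> U"
  shows "((f \<circ> inv_into U x) has_derivative (\<lambda>u. coord_tvec A (U, x) p u f)) (at (x p))"
proof -
  have "(f \<circ> inv_into U x) differentiable (at (x p))"
    using smooth_on_differentiable[OF smooth_fun_chart[OF assms(1,2)]] assms(3) by auto
  then show ?thesis using assms(1) by (simp add: coord_tvec_def frechet_derivative_works)
qed

lemma coord_tvec_add:
  assumes "(U, x) \<in> A" "p \<in> U"
  shows "coord_tvec A (U, x) p (u + v) = coord_tvec A (U, x) p u + coord_tvec A (U, x) p v"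
proof
  fix f
  show "coord_tvec A (U, x) p (u + v) f = (coord_tvec A (U, x) p u + coord_tvec A (U, x) p v) f"
  \<comment> \<open>Off the smooth functions both sides are 0 by the convention in
    \<open>coord_tvec\<close>.\<close>
  proof (cases "smooth_fun A f")
    case True
    show ?thesis
      using linear_add[OF has_derivative_linear[OF smooth_fun_chart_derivative[OF True assms]]]
      by simp
  qed (simp add: coord_tvec_def)
qed

lemma coord_tvec_scale:
  assumes "(U, x) \<in> A" "p \<in> U"
  shows "coord_tvec A (U, x) p (a *\<^sub>R u) = tscale a (coord_tvec A (U, x) p u)"
proof
  fix f
  show "coord_tvec A (U, x) p (a *\<^sub>R u) f = tscale a (coord_tvec A (U, x) p u) f"
  proof (cases "smooth_fun A f")
    case True
    show ?thesis
      using linear_scale[OF has_derivative_linear[OF smooth_fun_chart_derivative[OF True assms]]]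
      by (simp add: tscale_def)
  qed (simp add: coord_tvec_def tscale_def)
qed

text \<open>The chain rule for \<open>f\<close> read through the transition map: components
  transform by the Jacobian.\<close>

lemma coord_tvec_change:
  assumes Ux: "(U, x) \<in> A" and Vy: "(V, y) \<in> A" and p: "p \<in> U" "p \<in> V"
  shows "coord_tvec A (U, x) p u
    = coord_tvec A (V, y) p (frechet_derivative (y \<circ> inv_into U x) (at (x p)) u)"
proof
  fix f
  let ?d = "frechet_derivative (y \<circ> inv_into U x) (at (x p))"
  show "coord_tvec A (U, x) p u f = coord_tvec A (V, y) p (?d u) f"
  proof (cases "smooth_fun A f")
    case True
    have "((y \<circ> inv_into U x) has_derivative ?d) (at (x p))"
      using smooth_on_differentiable[OF transition_smooth[OF Ux Vy]] p
      by (auto simp flip: frechet_derivative_works)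
    moreover have "((f \<circ> inv_into V y) has_derivative (\<lambda>u. coord_tvec A (V, y) p u f))
        (at ((y \<circ> inv_into U x) (x p)))"
      using smooth_fun_chart_derivative[OF True Vy p(2)] p(1) by (simp add: chart_inv[OF Ux])
    ultimately have "((\<lambda>z. (f \<circ> inv_into V y) ((y \<circ> inv_into U x) z)) has_derivative
        (\<lambda>u. coord_tvec A (V, y) p (?d u) f)) (at (x p))"
      by (rule has_derivative_compose)
    then have "((f \<circ> inv_into U x) has_derivative (\<lambda>u. coord_tvec A (V, y) p (?d u) f)) (at (x p))"
      by (rule has_derivative_transform_within_open[OF _ chart_open_image[OF Ux chart_homeomorphism(1)[OF Vy]]])
        (use p in \<open>auto simp: chart_inv[OF Ux] chart_inv[OF Vy]\<close>)
    then show ?thesis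
      using fun_cong[OF has_derivative_unique[OF smooth_fun_chart_derivative[OF True Ux p(1)]]] by simp
  qed (simp add: coord_tvec_def)
qed

text \<open>The definition ranges over all charts around \<open>p\<close>; the change of coordinates
  absorbs them into a single one, and closure under the vector space operations becomes
  visible.\<close>

lemma tangent_space_chart:
  assumes "(U, x) \<in> A" "p \<in> U"
  shows "tangent_space A p = range (coord_tvec A (U, x) p)"
proof -
  have "coord_tvec A (V, y) p u \<in> range (coord_tvec A (U, x) p)" if "(V, y) \<in> A" "p \<in> V" for V y u
    using coord_tvec_change[OF that(1) assms(1) that(2) assms(2)] by auto
  then show ?thesis using assms unfolding tangent_space_def by auto
qed

lemma tangent_space_add: "v \<in> tangent_space A p \<Longrightarrow> w \<in> tangent_space A p \<Longrightarrow> v + w \<in> tangent_space A p"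
proof -
  assume vw: "v \<in> tangent_space A p" "w \<in> tangent_space A p"
  obtain U x where Ux: "(U, x) \<in> A" "p \<in> U" by (rule chart_at)
  then show ?thesis using vw by (auto simp: tangent_space_chart[OF Ux] simp flip: coord_tvec_add)
qed

lemma tangent_space_scale: "v \<in> tangent_space A p \<Longrightarrow> tscale a v \<in> tangent_space A p"
proof -
  assume v: "v \<in> tangent_space A p"
  obtain U x where Ux: "(U, x) \<in> A" "p \<in> U" by (rule chart_at)
  then show ?thesis using v by (auto simp: tangent_space_chart[OF Ux] simp flip: coord_tvec_scale)
qed

lemma tscale_zero: "tscale 0 v = 0" and tscale_minus_one: "tscale (- 1) v = - v"
  by (auto simp: tscale_def fun_eq_iff)

lemma tangent_space_zero: "0 \<in> tangent_space A p"
proof -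
  obtain U x where Ux: "(U, x) \<in> A" "p \<in> U" by (rule chart_at)
  have "coord_tvec A (U, x) p 0 \<in> tangent_space A p" using tangent_space_chart[OF Ux] by auto
  from tangent_space_scale[OF this, of 0] show ?thesis by (simp add: tscale_zero)
qed

lemma tangent_space_diff:
  "v \<in> tangent_space A p \<Longrightarrow> w \<in> tangent_space A p \<Longrightarrow> v - w \<in> tangent_space A p"
  using tangent_space_add[OF _ tangent_space_scale[of w p "-1"], of v] by (simp add: tscale_minus_one)

lemma tvec_add:
  assumes "v \<in> tangent_space A p" "smooth_fun A f" "smooth_fun A h"
  shows "v (\<lambda>q. f q + h q) = v f + v h"
proof -
  obtain U x where Ux: "(U, x) \<in> A" "p \<in> U" by (rule chart_at)
  obtain u where u: "v = coord_tvec A (U, x) p u" using assms(1) tangent_space_chart[OF Ux] by auto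
  note D = smooth_fun_chart_derivative[OF smooth_fun_add[OF assms(2,3)] Ux]
  have "(((\<lambda>q. f q + h q) \<circ> inv_into U x) has_derivative
      (\<lambda>u. coord_tvec A (U, x) p u f + coord_tvec A (U, x) p u h)) (at (x p))"
    using has_derivative_add[OF smooth_fun_chart_derivative[OF assms(2) Ux]
        smooth_fun_chart_derivative[OF assms(3) Ux]]
    by (simp add: o_def)
  from fun_cong[OF has_derivative_unique[OF D this], of u] show ?thesis unfolding u .
qed

lemma tvec_mult:
  assumes v: "v \<in> tangent_space A p" and "smooth_fun A f" "smooth_fun A h"
  shows "v (\<lambda>q. f q * h q) = f p * v h + v f * h p"
proof -
  obtain U x where Ux: "(U, x) \<in> A" "p \<in> U" by (rule chart_at)
  obtain u where u: "v = coord_tvec A (U, x) p u" using v tangent_space_chart[OF Ux] by auto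
  have "smooth_fun A (\<lambda>q. f q * h q)"
    using assms(2,3) by (rule smooth_fun_mult)
  note D = smooth_fun_chart_derivative[OF this Ux]
  have "((f \<circ> inv_into U x) has_derivative (\<lambda>u. coord_tvec A (U, x) p u f)) (at (x p))"
    "((h \<circ> inv_into U x) has_derivative (\<lambda>u. coord_tvec A (U, x) p u h)) (at (x p))"
    using smooth_fun_chart_derivative[OF _ Ux] assms(2,3) by blast+
  from has_derivative_mult[OF this]
  have "(((\<lambda>q. f q * h q) \<circ> inv_into U x) has_derivative
      (\<lambda>u. f p * coord_tvec A (U, x) p u h + coord_tvec A (U, x) p u f * h p)) (at (x p))"
    by (simp add: o_def chart_inv[OF Ux])
  from fun_cong[OF has_derivative_unique[OF D this], of u] show ?thesis unfolding u .
qed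

text \<open>Instantiated with f = \<phi> + \<psi> and h = g(Y,Z), this is how the conformal factor
  gets differentiated.\<close>

lemma tvec_exp_mult:
  assumes v: "v \<in> tangent_space A p" and "smooth_fun A f" "smooth_fun A h"
  shows "v (\<lambda>q. exp (f q) * h q) = exp (f p) * (v f * h p + v h)"
proof -
  obtain U x where Ux: "(U, x) \<in> A" "p \<in> U" by (rule chart_at)
  obtain u where u: "v = coord_tvec A (U, x) p u" using v tangent_space_chart[OF Ux] by auto
  have E: "smooth_fun A (\<lambda>q. exp (f q))"
    using assms(2) by (rule smooth_fun_exp)
  note D = smooth_fun_chart_derivative[OF this Ux]
  have "((f \<circ> inv_into U x) has_derivative (\<lambda>u. coord_tvec A (U, x) p u f)) (at (x p))"
    by (rule smooth_fun_chart_derivative[OF assms(2) Ux])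
  from has_derivative_exp[OF this]
  have "(((\<lambda>q. exp (f q)) \<circ> inv_into U x) has_derivative
      (\<lambda>u. coord_tvec A (U, x) p u f * exp (f p))) (at (x p))"
    by (simp add: o_def chart_inv[OF Ux])
  from fun_cong[OF has_derivative_unique[OF D this], of u]
  have "v (\<lambda>q. exp (f q)) = v f * exp (f p)" unfolding u .
  with tvec_mult[OF v E assms(3)] show ?thesis by (simp add: algebra_simps)
qed

lemma smooth_at_coord_tvec:
  assumes f: "smooth_fun A f" and Ux: "(U, x) \<in> A" "p \<in> U"
  shows "smooth_at A p (\<lambda>q. coord_tvec A (U, x) q u f)"
proof -
  have "smooth_on (x ` U) (\<lambda>z. frechet_derivative (f \<circ> inv_into U x) (at z) u)"
    by (rule smooth_on_frechet_derivative[OF smooth_fun_chart[OF f Ux(1)]])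
  from smooth_at_chart[OF Ux chart_homeomorphism(2)[OF Ux(1)] _ this] Ux(2) f
  show ?thesis by (simp add: coord_tvec_def)
qed

section \<open>Vector fields and local frames\<close>

lemma vector_field_tangent: "X \<in> vector_fields A \<Longrightarrow> X p \<in> tangent_space A p"
  by (simp add: vector_fields_def)

lemma vector_field_smooth: "X \<in> vector_fields A \<Longrightarrow> smooth_fun A f \<Longrightarrow> smooth_fun A (\<lambda>p. X p f)"
  by (simp add: vector_fields_def apply_field_def)

lemma vector_fieldI:
  assumes "\<And>p. X p \<in> tangent_space A p" "\<And>f p. smooth_fun A f \<Longrightarrow> smooth_at A p (\<lambda>p. X p f)"
  shows "X \<in> vector_fields A"
  using assms by (simp add: vector_fields_def apply_field_def smooth_funI)

lemma vector_fields_add: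
  assumes "X \<in> vector_fields A" "Y \<in> vector_fields A"
  shows "X + Y \<in> vector_fields A"
  using assms
  by (intro vector_fieldI)
    (simp_all add: tangent_space_add vector_field_tangent smooth_at_add smooth_fun_imp_smooth_at
      vector_field_smooth)

lemma vector_fields_diff:
  assumes "X \<in> vector_fields A" "Y \<in> vector_fields A"
  shows "X - Y \<in> vector_fields A"
  using assms
  by (intro vector_fieldI)
    (simp_all add: tangent_space_diff vector_field_tangent smooth_at_diff smooth_fun_imp_smooth_at
      vector_field_smooth)

lemma vector_fields_fscale:
  assumes "smooth_fun A h" "X \<in> vector_fields A"
  shows "h \<odot> X \<in> vector_fields A"
proof (rule vector_fieldI)
  show "(h \<odot> X) p \<in> tangent_space A p" for p
    using assms by (simp add: fscale_def tangent_space_scale vector_field_tangent)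
  show "smooth_at A p (\<lambda>p. (h \<odot> X) p f)" if "smooth_fun A f" for f p
    using assms that
    by (simp add: fscale_def tscale_def smooth_at_mult smooth_fun_imp_smooth_at vector_field_smooth)
qed

lemma vector_fields_zero: "0 \<in> vector_fields A"
  by (intro vector_fieldI) (simp_all add: tangent_space_zero smooth_at_const)

lemma vector_fields_sum:
  "(\<And>i. i \<in> I \<Longrightarrow> X i \<in> vector_fields A) \<Longrightarrow> (\<Sum>i\<in>I. X i) \<in> vector_fields A"
  by (induction I rule: infinite_finite_induct) (simp_all add: vector_fields_zero vector_fields_add)

lemma coord_tvec_sum:
  assumes "(U, x) \<in> A" "p \<in> U"
  shows "coord_tvec A (U, x) p (\<Sum>i\<in>I. c i *\<^sub>R u i) = (\<Sum>i\<in>I. tscale (c i) (coord_tvec A (U, x) p (u i)))"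
proof -
  have "coord_tvec A (U, x) p 0 = 0"
    using coord_tvec_scale[OF assms, of 0 0] by (simp add: tscale_zero)
  then show ?thesis
    by (induction I rule: infinite_finite_induct)
      (simp_all add: coord_tvec_add[OF assms] coord_tvec_scale[OF assms])
qed

text \<open>The fields and functions are defined globally and behave as a coordinate frame with its
  coordinates only on \<open>N\<close>; there \<open>v (\<xi> b)\<close> is the component of
  \<open>v\<close> along \<open>b\<close>.\<close>

definition local_frame :: "'a set \<Rightarrow> ('e \<Rightarrow> 'a vfield) \<Rightarrow> ('e \<Rightarrow> 'a \<Rightarrow> real) \<Rightarrow> bool" where
  "local_frame N E \<xi> \<longleftrightarrow> (\<forall>b. E b \<in> vector_fields A) \<and> (\<forall>b. smooth_fun A (\<xi> b)) \<and>
     (\<forall>q\<in>N. (\<forall>v\<in>tangent_space A q. v = (\<Sum>b\<in>Basis. tscale (v (\<xi> b)) (E b q))) \<and>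
        (\<forall>b\<in>Basis. \<forall>c\<in>Basis. E b q (\<xi> c) = (if b = c then 1 else 0)))"

lemma local_frame_smooth:
  assumes "local_frame N E \<xi>"
  shows "E b \<in> vector_fields A" "smooth_fun A (\<xi> b)"
  using assms by (simp_all add: local_frame_def)

lemma local_frame_expand:
  assumes "local_frame N E \<xi>" "q \<in> N" "v \<in> tangent_space A q"
  shows "v = (\<Sum>b\<in>Basis. tscale (v (\<xi> b)) (E b q))"
  using assms unfolding local_frame_def by blast

lemma local_frame_dual:
  assumes "local_frame N E \<xi>" "q \<in> N" "b \<in> Basis" "c \<in> Basis"
  shows "E b q (\<xi> c) = (if b = c then 1 else 0)"
  using assms by (simp add: local_frame_def)

lemma local_frame_exists: obtains N E \<xi> where "open N" "p \<in> N" "local_frame N E \<xi>"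
proof -
  obtain U x where Ux: "(U, x) \<in> A" and p: "p \<in> U" by (rule chart_at)
  obtain \<rho> N K where \<rho>: "smooth_fun A \<rho>" and N: "open N" "p \<in> N" "N \<subseteq> K" "closed K" "K \<subseteq> U"
    and \<rho>1: "\<And>q. q \<in> N \<Longrightarrow> \<rho> q = 1" and \<rho>0: "\<And>q. q \<notin> K \<Longrightarrow> \<rho> q = 0"
    using bump_fun[OF chart_homeomorphism(1)[OF Ux] p] by blast
  \<comment> \<open>Serves both the cut-off fields and the cut-off coordinates: at a point outside
    \<open>U\<close>, the complement of the closed set \<open>K\<close> is an open neighbourhood on
    which the extension vanishes.\<close>
  have extend: "smooth_at A q (\<lambda>q. if q \<in> U then \<rho> q * h q else 0)"
    if h: "\<And>q. q \<in> U \<Longrightarrow> smooth_at A q h" for q h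
  proof (cases "q \<in> U")
    case True
    show ?thesis
      by (rule smooth_at_cong[OF chart_homeomorphism(1)[OF Ux] True _
            smooth_at_mult[OF smooth_fun_imp_smooth_at[OF \<rho>] h[OF True]]]) simp
  next
    case False
    show ?thesis
      by (rule smooth_at_cong[OF open_Compl[OF N(4)] _ _ smooth_at_const[of q 0]])
        (use False N \<rho>0 in auto)
  qed
  define E where "E u q = (if q \<in> U then tscale (\<rho> q) (coord_tvec A (U, x) q u) else 0)" for u q
  define \<xi> where "\<xi> b q = (if q \<in> U then \<rho> q * (x q \<bullet> b) else 0)" for b q
  have E: "E u \<in> vector_fields A" for u
  proof (rule vector_fieldI)
    show "E u q \<in> tangent_space A q" for q
    proof (cases "q \<in> U")
      case True
      have "coord_tvec A (U, x) q u \<in> tangent_space A q" by (simp add: tangent_space_chart[OF Ux True])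
      with True show ?thesis by (simp add: E_def tangent_space_scale)
    qed (simp add: E_def tangent_space_zero)
    show "smooth_at A q (\<lambda>q. E u q f)" if "smooth_fun A f" for f q
    proof -
      have "(\<lambda>q. E u q f) = (\<lambda>q. if q \<in> U then \<rho> q * coord_tvec A (U, x) q u f else 0)"
        by (auto simp: E_def tscale_def)
      then show ?thesis using extend[OF smooth_at_coord_tvec[OF that Ux]] by simp
    qed
  qed
  have \<xi>: "smooth_fun A (\<xi> b)" for b
  proof (rule smooth_funI)
    show "smooth_at A q (\<xi> b)" for q
      unfolding \<xi>_def
      by (intro extend smooth_at_chart[OF Ux _ open_UNIV]) (auto intro: smooth_on_inner)
  qed
  \<comment> \<open>The cut-off is 1 on the open set \<open>N\<close>, so near \<open>q\<close> the
    function \<open>\<xi> b\<close> is the true coordinate, a linear projection in the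
    chart.\<close>
  have coord: "coord_tvec A (U, x) q u (\<xi> b) = u \<bullet> b" if "q \<in> N" for q u b
  proof -
    have q: "q \<in> U" using that N by auto
    have "((\<lambda>z. z \<bullet> b) has_derivative (\<lambda>u. u \<bullet> b)) (at (x q))"
      by (auto intro!: derivative_eq_intros)
    then have "(\<xi> b \<circ> inv_into U x has_derivative (\<lambda>u. u \<bullet> b)) (at (x q))"
      by (rule has_derivative_transform_within_open[OF _ chart_open_image[OF Ux N(1)]])
        (use q that in \<open>auto simp: \<xi>_def \<rho>1 chart_inv[OF Ux]\<close>)
    from fun_cong[OF has_derivative_unique[OF smooth_fun_chart_derivative[OF \<xi> Ux q] this]]
    show ?thesis .
  qed
  have EN: "E u q = coord_tvec A (U, x) q u" if "q \<in> N" for q u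
    using that N \<rho>1 by (auto simp: E_def tscale_def)
  have "v = (\<Sum>b\<in>Basis. tscale (v (\<xi> b)) (E b q))" if q: "q \<in> N" and v: "v \<in> tangent_space A q" for q v
  proof -
    have qU: "q \<in> U" using q N by auto
    obtain u where u: "v = coord_tvec A (U, x) q u" using v tangent_space_chart[OF Ux qU] by auto
    have "coord_tvec A (U, x) q (\<Sum>b\<in>Basis. (u \<bullet> b) *\<^sub>R b)
        = (\<Sum>b\<in>Basis. tscale (u \<bullet> b) (coord_tvec A (U, x) q b))"
      by (rule coord_tvec_sum[OF Ux qU])
    then show ?thesis unfolding u coord[OF q] EN[OF q] by (simp only: euclidean_representation)
  qed
  moreover have "E b q (\<xi> c) = (if b = c then 1 else 0)" if "q \<in> N" "b \<in> Basis" "c \<in> Basis" for q b c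
    using that by (simp add: EN coord inner_Basis)
  ultimately have "local_frame N E \<xi>" using E \<xi> unfolding local_frame_def by blast
  with N(1,2) show ?thesis by (rule that)
qed

text \<open>Nondegeneracy speaks of tangent vectors, but connections and duals only of fields;
  extending a vector with constant frame coefficients passes from one to the other.\<close>

lemma vector_field_through:
  assumes "v \<in> tangent_space A p"
  obtains Y where "Y \<in> vector_fields A" "Y p = v"
proof -
  obtain N E \<xi> where N: "open N" "p \<in> N" "local_frame N E \<xi>" by (rule local_frame_exists)
  have "(\<Sum>b\<in>Basis. (\<lambda>_. v (\<xi> b)) \<odot> E b) \<in> vector_fields A"
    by (intro vector_fields_sum vector_fields_fscale smooth_funI smooth_at_const
        local_frame_smooth(1)[OF N(3)])
  moreover have "(\<Sum>b\<in>Basis. (\<lambda>_. v (\<xi> b)) \<odot> E b) p = v"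
    using local_frame_expand[OF N(3,2) assms] by (simp add: sum_fun_apply fscale_def)
  ultimately show ?thesis by (rule that)
qed

text \<open>Gaussian elimination: the row \<open>b0\<close> is eliminated with a pivot column \<open>c0\<close> whose entry does
  not vanish at \<open>p\<close>; the equation for \<open>c0\<close> itself degenerates to \<open>0 = 0\<close>.\<close>

lemma smooth_at_linear_system:
  assumes "finite B"
    and "\<And>b c. b \<in> B \<Longrightarrow> c \<in> C \<Longrightarrow> smooth_at A p (a b c)"
    and "\<And>c. c \<in> C \<Longrightarrow> smooth_at A p (f c)"
    and "open N" "p \<in> N" "\<And>q c. q \<in> N \<Longrightarrow> c \<in> C \<Longrightarrow> (\<Sum>b\<in>B. s b q * a b c q) = f c q"
    and "\<And>d. (\<And>c. c \<in> C \<Longrightarrow> (\<Sum>b\<in>B. d b * a b c p) = 0) \<Longrightarrow> \<forall>b\<in>B. d b = (0::real)"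
    and "b \<in> B"
  shows "smooth_at A p (s b)"
  using assms
proof (induction B arbitrary: a f N b)
  case (insert b0 B)
  note a = insert.prems(1) and f = insert.prems(2) and N = insert.prems(3,4)
    and eq = insert.prems(5) and nd = insert.prems(6)
  \<comment> \<open>If all entries of the row \<open>b0\<close> vanished at \<open>p\<close>, the
    indicator of \<open>b0\<close> would be a nonzero kernel vector.\<close>
  have "\<exists>c0\<in>C. a b0 c0 p \<noteq> 0"
  proof (rule ccontr)
    assume "\<not> ?thesis"
    then have "(\<Sum>b\<in>insert b0 B. (if b = b0 then 1 else 0) * a b c p) = 0" if "c \<in> C" for c
      using that insert.hyps by (auto intro!: sum.neutral)
    from nd[OF this] show False by auto
  qed
  then obtain c0 where c0: "c0 \<in> C" "a b0 c0 p \<noteq> 0" by blast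
  have i: "smooth_at A p (\<lambda>q. inverse (a b0 c0 q))"
    using a[of b0 c0] c0 by (intro smooth_at_inverse) auto
  have "isCont (a b0 c0) p" using a[of b0 c0] c0 by (intro smooth_at_isCont) auto
  then obtain L where L: "open L" "p \<in> L" "\<And>q. q \<in> L \<Longrightarrow> a b0 c0 q \<noteq> 0"
    using c0(2) unfolding continuous_at_open by (elim allE[of _ "- {0}"]) auto
  have sB: "smooth_at A p (s b)" if "b \<in> B" for b
  proof (rule insert.IH[where N = "N \<inter> L"
        and a = "\<lambda>b c q. a b c q - a b c0 q * (a b0 c q * inverse (a b0 c0 q))"
        and f = "\<lambda>c q. f c q - f c0 q * (a b0 c q * inverse (a b0 c0 q))"])
    show "smooth_at A p (\<lambda>q. a b c q - a b c0 q * (a b0 c q * inverse (a b0 c0 q)))"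
      if "b \<in> B" "c \<in> C" for b c
      using that a c0 i by (intro smooth_at_diff smooth_at_mult) auto
    show "smooth_at A p (\<lambda>q. f c q - f c0 q * (a b0 c q * inverse (a b0 c0 q)))" if "c \<in> C" for c
      using that a f c0 i by (intro smooth_at_diff smooth_at_mult) auto
    show "(\<Sum>b\<in>B. s b q * (a b c q - a b c0 q * (a b0 c q * inverse (a b0 c0 q))))
        = f c q - f c0 q * (a b0 c q * inverse (a b0 c0 q))" if q: "q \<in> N \<inter> L" and "c \<in> C" for q c
    proof -
      \<comment> \<open>The multiple of column \<open>c0\<close> that is subtracted from column
        \<open>c\<close>; as \<open>a b0 c0 q * t = a b0 c q\<close>, the unknown
        \<open>s b0\<close> drops out.\<close>
      define t where "t = a b0 c q * inverse (a b0 c0 q)"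
      have "f c q = s b0 q * a b0 c q + (\<Sum>b\<in>B. s b q * a b c q)"
        "f c0 q = s b0 q * a b0 c0 q + (\<Sum>b\<in>B. s b q * a b c0 q)"
        using eq[of q c] eq[of q c0] insert.hyps q c0 \<open>c \<in> C\<close> by auto
      moreover have "a b0 c0 q * t = a b0 c q" using L(3) q by (simp add: t_def)
      ultimately have "(\<Sum>b\<in>B. s b q * a b c q) - (\<Sum>b\<in>B. s b q * a b c0 q) * t = f c q - f c0 q * t"
        by (simp add: algebra_simps)
      then show ?thesis
        unfolding t_def[symmetric] by (simp add: sum_subtractf sum_distrib_left algebra_simps)
    qed
    show "\<forall>b\<in>B. d b = 0"
      if d: "\<And>c. c \<in> C \<Longrightarrow> (\<Sum>b\<in>B. d b * (a b c p - a b c0 p * (a b0 c p * inverse (a b0 c0 p)))) = 0" for d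
    proof -
      \<comment> \<open>A kernel vector of the reduced matrix is lifted to the full one by the value
        at \<open>b0\<close> that satisfies the pivot equation.\<close>
      define d0 where "d0 = - (\<Sum>b\<in>B. d b * a b c0 p) * inverse (a b0 c0 p)"
      have "(\<Sum>b\<in>insert b0 B. (if b = b0 then d0 else d b) * a b c p) = 0" if "c \<in> C" for c
      proof -
        have "(\<Sum>b\<in>B. (if b = b0 then d0 else d b) * a b c p) = (\<Sum>b\<in>B. d b * a b c p)"
          using insert.hyps by (intro sum.cong) auto
        moreover have "(\<Sum>b\<in>B. d b * a b c p)
            = (\<Sum>b\<in>B. d b * a b c0 p) * (a b0 c p * inverse (a b0 c0 p))"
          using d[OF that] by (simp add: sum_subtractf sum_distrib_left algebra_simps)
        ultimately show ?thesis using insert.hyps by (simp add: d0_def)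
      qed
      from nd[OF this] show ?thesis using insert.hyps by (metis insertCI)
    qed
  qed (use N L that in auto)
  \<comment> \<open>Back substitution in the pivot equation.\<close>
  have "smooth_at A p (s b0)"
  proof (rule smooth_at_cong)
    show "smooth_at A p (\<lambda>q. (f c0 q - (\<Sum>b\<in>B. s b q * a b c0 q)) * inverse (a b0 c0 q))"
      using a f c0 i sB insert.hyps by (intro smooth_at_diff smooth_at_mult smooth_at_sum) auto
    show "(f c0 q - (\<Sum>b\<in>B. s b q * a b c0 q)) * inverse (a b0 c0 q) = s b0 q" if "q \<in> N \<inter> L" for q
      using eq[of q c0, symmetric] c0 L(3) insert.hyps that by auto
  qed (use N L in auto)
  with sB insert.prems(7) show ?case by auto
qed simp

section \<open>The Riesz representation of tensorial functionals\<close>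

text \<open>A 1-form seen as a homomorphism of modules over the smooth functions, the shape in which
  expressions built from connections present themselves.\<close>

definition tensorial :: "('a vfield \<Rightarrow> 'a \<Rightarrow> real) \<Rightarrow> bool" where
  "tensorial \<Lambda> \<longleftrightarrow> (\<forall>Y\<in>vector_fields A. smooth_fun A (\<Lambda> Y)) \<and>
     (\<forall>Y\<in>vector_fields A. \<forall>Z\<in>vector_fields A. \<forall>p. \<Lambda> (Y + Z) p = \<Lambda> Y p + \<Lambda> Z p) \<and>
     (\<forall>h Y p. smooth_fun A h \<longrightarrow> Y \<in> vector_fields A \<longrightarrow> \<Lambda> (h \<odot> Y) p = h p * \<Lambda> Y p)"

lemma tensorial_smooth: "tensorial \<Lambda> \<Longrightarrow> Y \<in> vector_fields A \<Longrightarrow> smooth_fun A (\<Lambda> Y)"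
  by (simp add: tensorial_def)

lemma tensorial_add:
  "tensorial \<Lambda> \<Longrightarrow> Y \<in> vector_fields A \<Longrightarrow> Z \<in> vector_fields A \<Longrightarrow> \<Lambda> (Y + Z) p = \<Lambda> Y p + \<Lambda> Z p"
  unfolding tensorial_def by fast

lemma tensorial_scale:
  "tensorial \<Lambda> \<Longrightarrow> smooth_fun A h \<Longrightarrow> Y \<in> vector_fields A \<Longrightarrow> \<Lambda> (h \<odot> Y) p = h p * \<Lambda> Y p"
  unfolding tensorial_def by fast

text \<open>Multiplying by a bump supported in \<open>N\<close> makes the two fields equal
  everywhere, while the factor pulled out at \<open>p\<close> is 1.\<close>

lemma tensorial_local:
  assumes "tensorial \<Lambda>" "Y \<in> vector_fields A" "Z \<in> vector_fields A"
    and "open N" "p \<in> N" "\<And>q. q \<in> N \<Longrightarrow> Y q = Z q"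
  shows "\<Lambda> Y p = \<Lambda> Z p"
proof -
  obtain \<rho> M K where \<rho>: "smooth_fun A \<rho>" "open M" "p \<in> M" "M \<subseteq> K" "closed K" "K \<subseteq> N"
    "\<And>q. q \<in> M \<Longrightarrow> \<rho> q = 1" "\<And>q. q \<notin> K \<Longrightarrow> \<rho> q = 0"
    using bump_fun[OF assms(4,5)] by blast
  have "(\<rho> \<odot> Y) q = (\<rho> \<odot> Z) q" for q
  proof (cases "q \<in> N")
    case True
    then show ?thesis by (simp add: fscale_def assms(6))
  next
    case False
    then have "\<rho> q = 0" using \<rho>(6,8) by blast
    then show ?thesis by (simp add: fscale_def tscale_zero)
  qed
  then have "\<rho> \<odot> Y = \<rho> \<odot> Z" by (rule ext)
  moreover have "\<Lambda> (\<rho> \<odot> Y) p = \<rho> p * \<Lambda> Y p" "\<Lambda> (\<rho> \<odot> Z) p = \<rho> p * \<Lambda> Z p"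
    using assms(1-3) \<rho>(1) by (simp_all add: tensorial_scale)
  ultimately show ?thesis using \<rho>(7)[OF \<rho>(3)] by simp
qed

lemma tensorial_sum:
  assumes \<Lambda>: "tensorial \<Lambda>" and "finite I"
    and "\<And>i. i \<in> I \<Longrightarrow> smooth_fun A (h i)" "\<And>i. i \<in> I \<Longrightarrow> Y i \<in> vector_fields A"
  shows "\<Lambda> (\<Sum>i\<in>I. h i \<odot> Y i) p = (\<Sum>i\<in>I. h i p * \<Lambda> (Y i) p)"
  using assms(2-)
proof (induction I)
  case empty
  have "\<Lambda> 0 p = \<Lambda> (0 + 0) p" by simp
  also have "\<dots> = \<Lambda> 0 p + \<Lambda> 0 p"
    by (rule tensorial_add[OF \<Lambda> vector_fields_zero vector_fields_zero])
  finally have "\<Lambda> 0 p = 0" by simp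
  then show ?case by (simp only: sum.empty)
next
  case (insert i I)
  have "h i \<odot> Y i \<in> vector_fields A" "(\<Sum>i\<in>I. h i \<odot> Y i) \<in> vector_fields A"
    using insert.prems by (auto intro!: vector_fields_fscale vector_fields_sum)
  then have "\<Lambda> (h i \<odot> Y i + (\<Sum>i\<in>I. h i \<odot> Y i)) p = \<Lambda> (h i \<odot> Y i) p + \<Lambda> (\<Sum>i\<in>I. h i \<odot> Y i) p"
    by (rule tensorial_add[OF \<Lambda>])
  moreover have "\<Lambda> (h i \<odot> Y i) p = h i p * \<Lambda> (Y i) p"
    using insert.prems by (simp add: tensorial_scale[OF \<Lambda>])
  moreover have "\<Lambda> (\<Sum>i\<in>I. h i \<odot> Y i) p = (\<Sum>i\<in>I. h i p * \<Lambda> (Y i) p)"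
    using insert.prems by (intro insert.IH) auto
  ultimately show ?case by (simp only: sum.insert[OF insert.hyps])
qed

text \<open>The frame expansion of \<open>Y\<close> holds only on \<open>N\<close>, but its
  right-hand side is a global field; locality permits the exchange and linearity pulls out the
  components. Hence the value at \<open>q\<close> depends on \<open>Y q\<close> alone.\<close>

lemma tensorial_frame:
  assumes \<Lambda>: "tensorial \<Lambda>" and N: "open N" "local_frame N E \<xi>"
    and Y: "Y \<in> vector_fields A" and q: "q \<in> N"
  shows "\<Lambda> Y q = (\<Sum>b\<in>Basis. Y q (\<xi> b) * \<Lambda> (E b) q)"
proof -
  note E = local_frame_smooth(1)[OF N(2)] and \<xi> = local_frame_smooth(2)[OF N(2)]
  have Y\<xi>: "smooth_fun A (\<lambda>p. Y p (\<xi> b))" for b by (rule vector_field_smooth[OF Y \<xi>])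
  have "\<Lambda> Y q = \<Lambda> (\<Sum>b\<in>Basis. (\<lambda>p. Y p (\<xi> b)) \<odot> E b) q"
  proof (rule tensorial_local[OF \<Lambda> Y _ N(1) q])
    show "(\<Sum>b\<in>Basis. (\<lambda>p. Y p (\<xi> b)) \<odot> E b) \<in> vector_fields A"
      by (intro vector_fields_sum vector_fields_fscale Y\<xi> E)
    show "Y q = (\<Sum>b\<in>Basis. (\<lambda>p. Y p (\<xi> b)) \<odot> E b) q" if "q \<in> N" for q
    proof -
      have "Y q = (\<Sum>b\<in>Basis. tscale (Y q (\<xi> b)) (E b q))"
        by (rule local_frame_expand[OF N(2) that vector_field_tangent[OF Y]])
      also have "\<dots> = (\<Sum>b\<in>Basis. (\<lambda>p. Y p (\<xi> b)) \<odot> E b) q"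
        by (simp add: sum_fun_apply fscale_def)
      finally show ?thesis .
    qed
  qed
  also have "\<dots> = (\<Sum>b\<in>Basis. Y q (\<xi> b) * \<Lambda> (E b) q)"
    by (rule tensorial_sum[OF \<Lambda> finite_Basis Y\<xi> E])
  finally show ?thesis .
qed

end

section \<open>The metric: frame expansions, the Gram matrix and representation of
  functionals\<close>

locale metric_manifold = manifold A
  for A :: "('a::{t2_space,second_countable_topology}, 'e::euclidean_space) atlas" +
  fixes g :: "'a form2"
  assumes metric: "pseudo_riemannian_metric A g"
begin

lemmas metric_conds = metric[unfolded pseudo_riemannian_metric_def]

lemma metric_sym:
  "v \<in> tangent_space A p \<Longrightarrow> w \<in> tangent_space A p \<Longrightarrow> g p v w = g p w v"
  by (rule metric_conds[THEN conjunct1, rule_format])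

lemma metric_add_left:
  "u \<in> tangent_space A p \<Longrightarrow> v \<in> tangent_space A p \<Longrightarrow> w \<in> tangent_space A p \<Longrightarrow>
    g p (u + v) w = g p u w + g p v w"
  by (rule metric_conds[THEN conjunct2, THEN conjunct1, rule_format])

lemma metric_scale_left:
  "v \<in> tangent_space A p \<Longrightarrow> w \<in> tangent_space A p \<Longrightarrow> g p (tscale a v) w = a * g p v w"
  by (rule metric_conds[THEN conjunct2, THEN conjunct2, THEN conjunct1, rule_format])

lemma metric_nondegenerate:
  "v \<in> tangent_space A p \<Longrightarrow> (\<And>w. w \<in> tangent_space A p \<Longrightarrow> g p v w = 0) \<Longrightarrow> v = 0"
  by (rule metric_conds[THEN conjunct2, THEN conjunct2, THEN conjunct2, THEN conjunct1, rule_format])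

lemma metric_smooth:
  "X \<in> vector_fields A \<Longrightarrow> Y \<in> vector_fields A \<Longrightarrow> smooth_fun A (eval2 g X Y)"
  by (rule metric_conds[THEN conjunct2, THEN conjunct2, THEN conjunct2, THEN conjunct2, rule_format])

lemma metric_diff_left:
  "u \<in> tangent_space A p \<Longrightarrow> v \<in> tangent_space A p \<Longrightarrow> w \<in> tangent_space A p \<Longrightarrow>
    g p (u - v) w = g p u w - g p v w"
  using metric_add_left[of "u - v" p v w] tangent_space_diff[of u p v]
  by (simp only: diff_add_cancel)

lemma metric_add_right:
  "u \<in> tangent_space A p \<Longrightarrow> v \<in> tangent_space A p \<Longrightarrow> w \<in> tangent_space A p \<Longrightarrow>
    g p w (u + v) = g p w u + g p w v"
  by (simp add: metric_sym[of w] tangent_space_add metric_add_left)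

lemma metric_scale_right:
  "v \<in> tangent_space A p \<Longrightarrow> w \<in> tangent_space A p \<Longrightarrow> g p w (tscale a v) = a * g p w v"
  by (simp add: metric_sym[of w] tangent_space_scale metric_scale_left)

lemma metric_tensorial:
  assumes "X \<in> vector_fields A"
  shows "tensorial (eval2 g X)"
  unfolding tensorial_def
proof (intro conjI ballI allI impI)
  show "smooth_fun A (eval2 g X Y)" if "Y \<in> vector_fields A" for Y
    by (rule metric_smooth[OF assms that])
  show "eval2 g X (Y + Z) p = eval2 g X Y p + eval2 g X Z p"
    if "Y \<in> vector_fields A" "Z \<in> vector_fields A" for Y Z p
    using metric_add_right[of "Y p" p "Z p" "X p"] assms that
    by (simp add: eval2_def vector_field_tangent)
  show "eval2 g X (h \<odot> Y) p = h p * eval2 g X Y p" if "Y \<in> vector_fields A" for h Y p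
    using assms that by (simp add: eval2_def fscale_def metric_scale_right vector_field_tangent)
qed

text \<open>Nondegeneracy tested against fields instead of vectors; the uniqueness half of
  \<open>riesz\<close> rests on it.\<close>

lemma metric_cancel:
  assumes "v \<in> tangent_space A p" "w \<in> tangent_space A p"
    and "\<And>Y. Y \<in> vector_fields A \<Longrightarrow> g p v (Y p) = g p w (Y p)"
  shows "v = w"
proof -
  have "g p (v - w) z = 0" if z: "z \<in> tangent_space A p" for z
  proof -
    obtain Y where "Y \<in> vector_fields A" "Y p = z" using vector_field_through[OF z] .
    then show ?thesis using assms z by (auto simp: metric_diff_left)
  qed
  with assms have "v - w = 0" by (intro metric_nondegenerate tangent_space_diff)
  then show ?thesis by simp
qed

lemma metric_frame:
  assumes N: "open N" "local_frame N E \<xi>" and q: "q \<in> N"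
    and w: "w \<in> tangent_space A q" and Y: "Y \<in> vector_fields A"
  shows "g q w (Y q) = (\<Sum>b\<in>Basis. w (\<xi> b) * g q (E b q) (Y q))"
proof -
  obtain W where W: "W \<in> vector_fields A" "W q = w" using vector_field_through[OF w] .
  have E: "E b \<in> vector_fields A" for b by (rule local_frame_smooth(1)[OF N(2)])
  \<comment> \<open>Symmetry moves \<open>w\<close> to the slot in which the metric is known to be
    tensorial; the extension \<open>W\<close> is needed because that expansion speaks of
    fields.\<close>
  have "g q w (Y q) = eval2 g Y W q"
    using W Y w by (simp add: eval2_def metric_sym vector_field_tangent)
  also have "\<dots> = (\<Sum>b\<in>Basis. W q (\<xi> b) * eval2 g Y (E b) q)"
    by (rule tensorial_frame[OF metric_tensorial[OF Y] N W(1) q])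
  also have "\<dots> = (\<Sum>b\<in>Basis. w (\<xi> b) * g q (E b q) (Y q))"
    using W E Y by (simp add: eval2_def metric_sym[of "Y q" q] vector_field_tangent)
  finally show ?thesis .
qed

text \<open>A kernel vector of the Gram matrix yields a tangent vector orthogonal to the frame,
  hence to every field, hence zero; the functions \<xi> then read off that its coefficients
  vanish.\<close>

lemma metric_frame_nondegenerate:
  assumes N: "open N" "local_frame N E \<xi>" and q: "q \<in> N"
    and d: "\<And>c. c \<in> Basis \<Longrightarrow> (\<Sum>b\<in>Basis. d b * g q (E b q) (E c q)) = 0"
  shows "\<forall>b\<in>Basis. d b = 0"
proof -
  have E: "E b \<in> vector_fields A" for b by (rule local_frame_smooth(1)[OF N(2)])
  define W where "W = (\<Sum>b\<in>Basis. (\<lambda>_. d b) \<odot> E b)"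
  have W: "W \<in> vector_fields A"
    unfolding W_def by (intro vector_fields_sum vector_fields_fscale E smooth_funI smooth_at_const)
  have W\<xi>: "W q (\<xi> c) = d c" if "c \<in> Basis" for c
  proof -
    have "W q (\<xi> c) = (\<Sum>b\<in>Basis. d b * E b q (\<xi> c))"
      by (simp add: W_def sum_fun_apply fscale_def tscale_def)
    also have "\<dots> = (\<Sum>b\<in>Basis. if b = c then d b else 0)"
      using local_frame_dual[OF N(2) q _ that] by (intro sum.cong) auto
    also have "\<dots> = d c" using that by simp
    finally show ?thesis .
  qed
  note Wq = vector_field_tangent[OF W, of q]
  have WE: "g q (W q) (E c q) = 0" if "c \<in> Basis" for c
    using metric_frame[OF N q Wq E, of c] d[OF that] by (simp add: W\<xi>)
  have "W q = 0"
  proof (rule metric_cancel[OF Wq tangent_space_zero])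
    fix Y assume Y: "Y \<in> vector_fields A"
    have "g q (W q) (Y q) = (\<Sum>b\<in>Basis. Y q (\<xi> b) * g q (W q) (E b q))"
      using tensorial_frame[OF metric_tensorial[OF W] N Y q] by (simp add: eval2_def)
    also have "\<dots> = 0" by (simp add: WE)
    also have "\<dots> = g q 0 (Y q)"
      using metric_scale_left[OF tangent_space_zero vector_field_tangent[OF Y], of q 0]
      by (simp add: tscale_zero)
    finally show "g q (W q) (Y q) = g q 0 (Y q)" .
  qed
  then show ?thesis using W\<xi> by auto
qed

text \<open>The Gram matrix becomes an endomorphism \<open>G\<close> of the finite-dimensional model
  space, where injectivity already yields surjectivity and thus the components of
  \<open>w\<close>.\<close>

lemma riesz_pointwise:
  assumes \<Lambda>: "tensorial \<Lambda>"
  obtains w where "w \<in> tangent_space A p" "\<And>Y. Y \<in> vector_fields A \<Longrightarrow> g p w (Y p) = \<Lambda> Y p"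
proof -
  obtain N E \<xi> where N: "open N" "p \<in> N" "local_frame N E \<xi>" by (rule local_frame_exists)
  have E: "E b \<in> vector_fields A" for b by (rule local_frame_smooth(1)[OF N(3)])
  define G where "G u = (\<Sum>c\<in>Basis. (\<Sum>b\<in>Basis. (u \<bullet> b) * g p (E b p) (E c p)) *\<^sub>R c)" for u :: 'e
  have Gc: "G u \<bullet> c = (\<Sum>b\<in>Basis. (u \<bullet> b) * g p (E b p) (E c p))" if "c \<in> Basis" for u c
    using that by (simp add: G_def)
  have "linear G"
    by (rule linearI; rule euclidean_eqI)
      (simp_all add: Gc inner_add_left sum.distrib distrib_right sum_distrib_left mult.assoc)
  moreover have "inj G"
  proof (subst linear_injective_0[OF \<open>linear G\<close>], intro allI impI)
    fix u assume "G u = 0"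
    then have "(\<Sum>b\<in>Basis. (u \<bullet> b) * g p (E b p) (E c p)) = 0" if "c \<in> Basis" for c
      using Gc[OF that, of u] by simp
    from metric_frame_nondegenerate[OF N(1,3,2) this] show "u = 0" by (simp add: euclidean_all_zero_iff)
  qed
  ultimately have "surj G" by (rule linear_injective_imp_surjective) simp
  then obtain u where "G u = (\<Sum>c\<in>Basis. \<Lambda> (E c) p *\<^sub>R c)" by (metis surjD)
  then have u: "(\<Sum>b\<in>Basis. (u \<bullet> b) * g p (E b p) (E c p)) = \<Lambda> (E c) p" if "c \<in> Basis" for c
    using Gc[OF that, of u] that by simp
  define W where "W = (\<Sum>b\<in>Basis. (\<lambda>_. u \<bullet> b) \<odot> E b)"
  have W: "W \<in> vector_fields A"
    unfolding W_def by (intro vector_fields_sum vector_fields_fscale E smooth_funI smooth_at_const)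
  have WE: "g p (W p) (E c p) = \<Lambda> (E c) p" if "c \<in> Basis" for c
  proof -
    have "g p (W p) (E c p) = eval2 g (E c) W p"
      using W E by (simp add: eval2_def metric_sym vector_field_tangent)
    also have "\<dots> = (\<Sum>b\<in>Basis. (u \<bullet> b) * eval2 g (E c) (E b) p)"
      unfolding W_def
      by (rule tensorial_sum[OF metric_tensorial[OF E] finite_Basis _ E])
        (intro smooth_funI smooth_at_const)
    also have "\<dots> = (\<Sum>b\<in>Basis. (u \<bullet> b) * g p (E b p) (E c p))"
      using E by (simp add: eval2_def metric_sym[of "E c p" p] vector_field_tangent)
    finally show ?thesis using u[OF that] by simp
  qed
  show ?thesis
  proof (rule that)
    show "W p \<in> tangent_space A p" by (rule vector_field_tangent[OF W])
    show "g p (W p) (Y p) = \<Lambda> Y p" if "Y \<in> vector_fields A" for Y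
      using tensorial_frame[OF metric_tensorial[OF W] N(1,3) that N(2)]
        tensorial_frame[OF \<Lambda> N(1,3) that N(2)] WE by (simp add: eval2_def)
  qed
qed

theorem riesz:
  assumes \<Lambda>: "tensorial \<Lambda>"
  shows "\<exists>!W. W \<in> vector_fields A \<and> (\<forall>Y\<in>vector_fields A. eval2 g W Y = \<Lambda> Y)"
proof (rule ex_ex1I)
  have "\<exists>w. w \<in> tangent_space A p \<and> (\<forall>Y\<in>vector_fields A. g p w (Y p) = \<Lambda> Y p)" for p
    by (rule riesz_pointwise[OF \<Lambda>, of p]) blast
  then have "\<exists>W. \<forall>p. W p \<in> tangent_space A p \<and> (\<forall>Y\<in>vector_fields A. g p (W p) (Y p) = \<Lambda> Y p)"
    by (intro choice allI)
  then obtain W where W: "\<And>p. W p \<in> tangent_space A p"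
    "\<And>p Y. Y \<in> vector_fields A \<Longrightarrow> g p (W p) (Y p) = \<Lambda> Y p" by blast
  have "W \<in> vector_fields A"
  proof (rule vector_fieldI[OF W(1)])
    fix f p assume f: "smooth_fun A f"
    obtain N E \<xi> where N: "open N" "p \<in> N" "local_frame N E \<xi>" by (rule local_frame_exists)
    have E: "E b \<in> vector_fields A" for b by (rule local_frame_smooth(1)[OF N(3)])
    \<comment> \<open>\<open>W\<close> was picked point by point without any regularity. Its
      components solve the Gram system on \<open>N\<close>, whose entries and right-hand sides are
      smooth and which is nonsingular at \<open>p\<close>.\<close>
    have s: "smooth_at A p (\<lambda>q. W q (\<xi> b))" if "b \<in> Basis" for b
    proof (rule smooth_at_linear_system[of Basis Basis p "\<lambda>b c q. g q (E b q) (E c q)" "\<lambda>c. \<Lambda> (E c)" N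
          "\<lambda>b q. W q (\<xi> b)"])
      show "smooth_at A p (\<lambda>q. g q (E b q) (E c q))" for b c
        using smooth_fun_imp_smooth_at[OF metric_smooth[OF E E]] by (simp add: eval2_def)
      show "smooth_at A p (\<Lambda> (E c))" for c
        by (rule smooth_fun_imp_smooth_at[OF tensorial_smooth[OF \<Lambda> E]])
      show "(\<Sum>b\<in>Basis. W q (\<xi> b) * g q (E b q) (E c q)) = \<Lambda> (E c) q" if "q \<in> N" for q c
        using metric_frame[OF N(1,3) that W(1) E] W(2)[OF E] by simp
    qed (use N that metric_frame_nondegenerate[OF N(1,3,2)] in auto)
    show "smooth_at A p (\<lambda>p. W p f)"
    proof (rule smooth_at_cong[OF N(1,2)])
      show "smooth_at A p (\<lambda>q. \<Sum>b\<in>Basis. W q (\<xi> b) * E b q f)"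
        by (intro smooth_at_sum smooth_at_mult s finite_Basis
            smooth_fun_imp_smooth_at[OF vector_field_smooth[OF E f]])
      show "(\<Sum>b\<in>Basis. W q (\<xi> b) * E b q f) = W q f" if q: "q \<in> N" for q
      proof -
        have "W q = (\<Sum>b\<in>Basis. tscale (W q (\<xi> b)) (E b q))"
          by (rule local_frame_expand[OF N(3) q W(1)])
        from fun_cong[OF this, of f] show ?thesis by (simp add: sum_fun_apply tscale_def)
      qed
    qed
  qed
  then show "\<exists>W. W \<in> vector_fields A \<and> (\<forall>Y\<in>vector_fields A. eval2 g W Y = \<Lambda> Y)"
    using W(2) by (intro exI[of _ W]) (auto simp: eval2_def)
next
  fix W W'
  assume W: "W \<in> vector_fields A \<and> (\<forall>Y\<in>vector_fields A. eval2 g W Y = \<Lambda> Y)"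
    and W': "W' \<in> vector_fields A \<and> (\<forall>Y\<in>vector_fields A. eval2 g W' Y = \<Lambda> Y)"
  show "W = W'"
  proof
    show "W p = W' p" for p
    proof (rule metric_cancel)
      show "g p (W p) (Y p) = g p (W' p) (Y p)" if "Y \<in> vector_fields A" for Y
      proof -
        have "eval2 g W Y = eval2 g W' Y" using W W' that by simp
        from fun_cong[OF this, of p] show ?thesis by (simp add: eval2_def)
      qed
    qed (use W W' in \<open>simp_all add: vector_field_tangent\<close>)
  qed
qed

end

section \<open>Conformal-projective transformations\<close>

lemma cp_tensor_apply:
  "cp_tensor A g \<alpha> \<beta> X Y p f = X p \<alpha> * Y p f + Y p \<alpha> * X p f - g p (X p) (Y p) * grad A g \<beta> p f"
  by (simp add: cp_tensor_def eval1_def eval2_def differential_def fscale_def tscale_def)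

context manifold
begin

lemma differential_tensorial:
  assumes "smooth_fun A f"
  shows "tensorial (eval1 (differential f))"
  using assms
  by (simp add: tensorial_def eval1_def differential_def fscale_def tscale_def vector_field_smooth)

lemma affine_connection_closed:
  "affine_connection A D \<Longrightarrow> X \<in> vector_fields A \<Longrightarrow> Y \<in> vector_fields A \<Longrightarrow> D X Y \<in> vector_fields A"
  by (simp add: affine_connection_def)

lemma affine_connection_rules:
  assumes "affine_connection A D" "X \<in> vector_fields A" "Y \<in> vector_fields A" "Z \<in> vector_fields A"
    "smooth_fun A h"
  shows "D (X + Y) Z = D X Z + D Y Z" "D X (Y + Z) = D X Y + D X Z"
    "D (h \<odot> X) Y = h \<odot> D X Y" "D X (h \<odot> Y) = apply_field X h \<odot> Y + h \<odot> D X Y"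
  using assms unfolding affine_connection_def by simp_all

lemma one_form_zero: "one_form A (\<lambda>_ _. 0)"
  by (simp add: one_form_def eval1_def smooth_funI smooth_at_const)

lemma SMT_eq_SWMT: "SMT A g D \<longleftrightarrow> SWMT A g (\<lambda>_ _. 0) D"
proof -
  have "eval1 (\<lambda>_ _. 0) X * h + k = k" "k + eval1 (\<lambda>_ _. 0) X * h = k" for X :: "'a vfield" and h k
    by (simp_all add: fun_eq_iff eval1_def)
  then show ?thesis by (simp add: SMT_def SWMT_def one_form_zero)
qed

end

lemma dual_connection_eq_semi_dual:
  "dual_connection A g D X Z = semi_dual_connection A g (\<lambda>_ _. 0) D X Z"
proof -
  have "k - eval1 (\<lambda>_ _. 0) X * h = k" for h k
    by (simp add: fun_eq_iff eval1_def)
  then show ?thesis by (simp add: dual_connection_def semi_dual_connection_def)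
qed

section \<open>Gradients, the correction tensor and the transformed metric and connection\<close>

context metric_manifold
begin

lemma grad_field: "smooth_fun A f \<Longrightarrow> grad A g f \<in> vector_fields A"
  and grad_metric: "smooth_fun A f \<Longrightarrow> Z \<in> vector_fields A \<Longrightarrow> g p (grad A g f p) (Z p) = Z p f"
proof -
  assume "smooth_fun A f"
  from theI'[OF riesz[OF differential_tensorial[OF this]]]
  have G: "grad A g f \<in> vector_fields A \<and>
      (\<forall>X\<in>vector_fields A. eval2 g (grad A g f) X = eval1 (differential f) X)"
    unfolding grad_def .
  then show "grad A g f \<in> vector_fields A" ..
  assume "Z \<in> vector_fields A"
  with G have "eval2 g (grad A g f) Z = eval1 (differential f) Z" by simp
  from fun_cong[OF this, of p] show "g p (grad A g f p) (Z p) = Z p f"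
    by (simp add: eval2_def eval1_def differential_def)
qed

lemma cp_tensor_field:
  assumes "smooth_fun A \<alpha>" "smooth_fun A \<beta>" "X \<in> vector_fields A" "Y \<in> vector_fields A"
  shows "cp_tensor A g \<alpha> \<beta> X Y \<in> vector_fields A"
  unfolding cp_tensor_def
  using assms
  by (intro vector_fields_add vector_fields_diff vector_fields_fscale grad_field
      tensorial_smooth[OF differential_tensorial] metric_smooth)

text \<open>Pairing with \<open>Z\<close> turns the gradient into d\<beta>; the metric computations
  below use this gradient-free form.\<close>

lemma cp_tensor_metric:
  assumes "smooth_fun A \<alpha>" "smooth_fun A \<beta>"
    and X: "X \<in> vector_fields A" and Y: "Y \<in> vector_fields A" and Z: "Z \<in> vector_fields A"
  shows "g p (cp_tensor A g \<alpha> \<beta> X Y p) (Z p)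
    = X p \<alpha> * g p (Y p) (Z p) + Y p \<alpha> * g p (X p) (Z p) - g p (X p) (Y p) * Z p \<beta>"
proof -
  note T = vector_field_tangent[OF X, of p] vector_field_tangent[OF Y, of p]
    vector_field_tangent[OF Z, of p] vector_field_tangent[OF grad_field[OF assms(2)], of p]
  have "cp_tensor A g \<alpha> \<beta> X Y p
      = tscale (X p \<alpha>) (Y p) + tscale (Y p \<alpha>) (X p) - tscale (g p (X p) (Y p)) (grad A g \<beta> p)"
    by (rule ext) (simp add: cp_tensor_apply tscale_def)
  then have "g p (cp_tensor A g \<alpha> \<beta> X Y p) (Z p)
      = g p (tscale (X p \<alpha>) (Y p) + tscale (Y p \<alpha>) (X p) - tscale (g p (X p) (Y p)) (grad A g \<beta> p)) (Z p)"
    by (rule arg_cong)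
  also have "\<dots> = X p \<alpha> * g p (Y p) (Z p) + Y p \<alpha> * g p (X p) (Z p) - g p (X p) (Y p) * Z p \<beta>"
    by (simp only: T tangent_space_add tangent_space_scale metric_add_left metric_diff_left
        metric_scale_left grad_metric[OF assms(2) Z])
  finally show ?thesis .
qed

text \<open>The reason why the transformation leaves the torsion unchanged.\<close>

lemma cp_tensor_sym:
  assumes "X \<in> vector_fields A" "Y \<in> vector_fields A"
  shows "cp_tensor A g \<alpha> \<beta> X Y = cp_tensor A g \<alpha> \<beta> Y X"
  by (intro ext)
    (simp add: cp_tensor_apply metric_sym[OF vector_field_tangent[OF assms(1)] vector_field_tangent[OF assms(2)]])

text \<open>Allows the results on metrics, \<open>riesz\<close> above all, to be reused for the
  transformed metric.\<close>

lemma cp_metric_pseudo_riemannian: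
  assumes "smooth_fun A \<phi>" "smooth_fun A \<psi>"
  shows "pseudo_riemannian_metric A (cp_metric g \<phi> \<psi>)"
  unfolding pseudo_riemannian_metric_def
proof (intro conjI allI ballI impI)
  show "cp_metric g \<phi> \<psi> p v w = cp_metric g \<phi> \<psi> p w v"
    if "v \<in> tangent_space A p" "w \<in> tangent_space A p" for p v w
    using metric_sym[OF that] by (simp add: cp_metric_def)
  show "cp_metric g \<phi> \<psi> p (u + v) w = cp_metric g \<phi> \<psi> p u w + cp_metric g \<phi> \<psi> p v w"
    if "u \<in> tangent_space A p" "v \<in> tangent_space A p" "w \<in> tangent_space A p" for p u v w
    unfolding cp_metric_def metric_add_left[OF that] by (rule distrib_left)
  show "cp_metric g \<phi> \<psi> p (tscale a v) w = a * cp_metric g \<phi> \<psi> p v w"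
    if "v \<in> tangent_space A p" "w \<in> tangent_space A p" for p v w a
    unfolding cp_metric_def metric_scale_left[OF that] by simp
  show "v = 0" if "v \<in> tangent_space A p" "\<forall>w\<in>tangent_space A p. cp_metric g \<phi> \<psi> p v w = 0" for p v
    using that unfolding cp_metric_def by (intro metric_nondegenerate[of v p]) auto
  show "smooth_fun A (eval2 (cp_metric g \<phi> \<psi>) X Y)"
    if "X \<in> vector_fields A" "Y \<in> vector_fields A" for X Y
    using smooth_fun_mult[OF smooth_fun_exp[OF smooth_fun_add[OF assms]] metric_smooth[OF that]]
    by (simp add: eval2_def cp_metric_def)
qed

lemma tvec_cp_metric:
  assumes "smooth_fun A \<phi>" "smooth_fun A \<psi>" "v \<in> tangent_space A p"
    and "Y \<in> vector_fields A" "Z \<in> vector_fields A"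
  shows "v (eval2 (cp_metric g \<phi> \<psi>) Y Z)
    = exp (\<phi> p + \<psi> p) * ((v \<phi> + v \<psi>) * g p (Y p) (Z p) + v (eval2 g Y Z))"
  using tvec_exp_mult[OF assms(3) smooth_fun_add[OF assms(1,2)] metric_smooth[OF assms(4,5)]]
    tvec_add[OF assms(3,1,2)]
  by (simp add: eval2_def cp_metric_def)

text \<open>The correction is linear over the smooth functions in both slots, so the Leibniz term is
  inherited from \<open>D\<close> alone.\<close>

lemma cp_connection_affine:
  assumes D: "affine_connection A D" and f: "smooth_fun A \<phi>" "smooth_fun A \<psi>"
  shows "affine_connection A (cp_connection A g D \<phi> \<psi>)"
  unfolding affine_connection_def
proof (intro conjI allI ballI impI)
  let ?D = "cp_connection A g D \<phi> \<psi>"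
  fix X Y assume X: "X \<in> vector_fields A" and Y: "Y \<in> vector_fields A"
  note T = vector_field_tangent[OF X] vector_field_tangent[OF Y]
  show "?D X Y \<in> vector_fields A"
    unfolding cp_connection_def
    by (intro vector_fields_add affine_connection_closed[OF D] cp_tensor_field f X Y)
  {
    fix Z assume Z: "Z \<in> vector_fields A"
    note T = T vector_field_tangent[OF Z]
    have "cp_tensor A g \<phi> \<psi> (X + Y) Z p u = cp_tensor A g \<phi> \<psi> X Z p u + cp_tensor A g \<phi> \<psi> Y Z p u" for p u
      using metric_add_left[OF T(1,2,3)] by (simp add: cp_tensor_apply algebra_simps)
    then show "?D (X + Y) Z = ?D X Z + ?D Y Z"
      unfolding cp_connection_def affine_connection_rules(1)[OF D X Y Z f(1)] by (auto simp: fun_eq_iff)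
    have "cp_tensor A g \<phi> \<psi> X (Y + Z) p u = cp_tensor A g \<phi> \<psi> X Y p u + cp_tensor A g \<phi> \<psi> X Z p u" for p u
      using metric_add_right[OF T(2,3,1)] by (simp add: cp_tensor_apply algebra_simps)
    then show "?D X (Y + Z) = ?D X Y + ?D X Z"
      unfolding cp_connection_def affine_connection_rules(2)[OF D X Y Z f(1)] by (auto simp: fun_eq_iff)
  }
  fix h assume h: "smooth_fun A h"
  have "cp_tensor A g \<phi> \<psi> (h \<odot> X) Y p u = h p * cp_tensor A g \<phi> \<psi> X Y p u" for p u
    using metric_scale_left[OF T] by (simp add: cp_tensor_apply fscale_def tscale_def algebra_simps)
  then show "?D (h \<odot> X) Y = h \<odot> ?D X Y"
    unfolding cp_connection_def affine_connection_rules(3)[OF D X Y Y h]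
    by (simp add: fun_eq_iff fscale_def tscale_def algebra_simps)
  have "cp_tensor A g \<phi> \<psi> X (h \<odot> Y) p u = h p * cp_tensor A g \<phi> \<psi> X Y p u" for p u
    using metric_scale_right[OF T(2,1)] by (simp add: cp_tensor_apply fscale_def tscale_def algebra_simps)
  then show "?D X (h \<odot> Y) = apply_field X h \<odot> Y + h \<odot> ?D X Y"
    unfolding cp_connection_def affine_connection_rules(4)[OF D X Y Y h]
    by (simp add: fun_eq_iff fscale_def tscale_def algebra_simps)
qed

section \<open>Semi-dual connections and their transformation\<close>

lemma semi_dual_connection_ex1:
  assumes D: "affine_connection A D" and \<eta>: "one_form A \<eta>"
    and X: "X \<in> vector_fields A" and Z: "Z \<in> vector_fields A"
  shows "\<exists>!W. W \<in> vector_fields A \<and> (\<forall>Y\<in>vector_fields A.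
    apply_field X (eval2 g Y Z) = eval2 g (D X Y) Z + eval2 g Y W - eval1 \<eta> X * eval2 g Y Z)"
proof -
  \<comment> \<open>The defining equation solved for g(Y,W). When \<open>Y\<close> is multiplied by
    \<open>h\<close>, the first two terms each pick up X(h) g(Y,Z), once from the product rule and
    once from the connection; their difference is linear over the functions.\<close>
  define \<Lambda> where "\<Lambda> Y p = X p (eval2 g Y Z) - g p (D X Y p) (Z p) + \<eta> p (X p) * g p (Y p) (Z p)" for Y p
  note TX = vector_field_tangent[OF X] and TZ = vector_field_tangent[OF Z]
  have "tensorial \<Lambda>"
    unfolding tensorial_def
  proof (intro conjI allI ballI impI)
    fix Y assume Y: "Y \<in> vector_fields A"
    note TY = vector_field_tangent[OF Y]
    have "smooth_fun A (eval1 \<eta> X)" using \<eta> X by (simp add: one_form_def)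
    from smooth_fun_add[OF smooth_fun_diff[OF vector_field_smooth[OF X metric_smooth[OF Y Z]]
          metric_smooth[OF affine_connection_closed[OF D X Y] Z]] smooth_fun_mult[OF this metric_smooth[OF Y Z]]]
    show "smooth_fun A (\<Lambda> Y)" unfolding \<Lambda>_def eval1_def eval2_def .
    {
      fix Y' p assume Y': "Y' \<in> vector_fields A"
      note TY' = vector_field_tangent[OF Y']
      have "eval2 g (Y + Y') Z = (\<lambda>q. eval2 g Y Z q + eval2 g Y' Z q)"
        using metric_add_left[OF TY TY' TZ] by (simp add: eval2_def)
      then have "X p (eval2 g (Y + Y') Z) = X p (eval2 g Y Z) + X p (eval2 g Y' Z)"
        using tvec_add[OF TX metric_smooth[OF Y Z] metric_smooth[OF Y' Z]] by simp
      moreover have "g p (D X (Y + Y') p) (Z p) = g p (D X Y p) (Z p) + g p (D X Y' p) (Z p)"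
        using metric_add_left[OF vector_field_tangent[OF affine_connection_closed[OF D X Y]]
            vector_field_tangent[OF affine_connection_closed[OF D X Y']] TZ, of p]
        unfolding affine_connection_rules(2)[OF D X Y Y' vector_field_smooth[OF X metric_smooth[OF Y Z]]]
        by simp
      moreover have "g p ((Y + Y') p) (Z p) = g p (Y p) (Z p) + g p (Y' p) (Z p)"
        using metric_add_left[OF TY TY' TZ] by simp
      ultimately show "\<Lambda> (Y + Y') p = \<Lambda> Y p + \<Lambda> Y' p"
        unfolding \<Lambda>_def by (simp only: algebra_simps)
    next
      fix h p assume h: "smooth_fun A h"
      note TD = vector_field_tangent[OF affine_connection_closed[OF D X Y]]
      have "eval2 g (h \<odot> Y) Z = (\<lambda>q. h q * eval2 g Y Z q)"
        using metric_scale_left[OF TY TZ] by (simp add: eval2_def fscale_def)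
      then have "X p (eval2 g (h \<odot> Y) Z) = h p * X p (eval2 g Y Z) + X p h * g p (Y p) (Z p)"
        using tvec_mult[OF TX h metric_smooth[OF Y Z]] by (simp add: eval2_def)
      moreover have "g p (D X (h \<odot> Y) p) (Z p) = X p h * g p (Y p) (Z p) + h p * g p (D X Y p) (Z p)"
        using metric_add_left[OF tangent_space_scale[OF TY] tangent_space_scale[OF TD] TZ, of p "X p h" "h p"]
        unfolding affine_connection_rules(4)[OF D X Y Y h]
        by (simp add: fscale_def apply_field_def metric_scale_left[OF TY TZ] metric_scale_left[OF TD TZ])
      moreover have "g p ((h \<odot> Y) p) (Z p) = h p * g p (Y p) (Z p)"
        using metric_scale_left[OF TY TZ] by (simp add: fscale_def)
      ultimately show "\<Lambda> (h \<odot> Y) p = h p * \<Lambda> Y p"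
        unfolding \<Lambda>_def by (simp only: algebra_simps)
    }
  qed
  moreover have "apply_field X (eval2 g Y Z) = eval2 g (D X Y) Z + eval2 g Y W - eval1 \<eta> X * eval2 g Y Z
      \<longleftrightarrow> eval2 g W Y = \<Lambda> Y" if "W \<in> vector_fields A" "Y \<in> vector_fields A" for W Y
    using metric_sym[OF vector_field_tangent[OF that(1)] vector_field_tangent[OF that(2)]]
    by (auto simp: fun_eq_iff \<Lambda>_def apply_field_def eval1_def eval2_def algebra_simps)
  ultimately show ?thesis using riesz[of \<Lambda>] by (simp cong: conj_cong ball_cong)
qed

lemma semi_dual_connection_eqI:
  assumes D: "affine_connection A D" and \<eta>: "one_form A \<eta>"
    and X: "X \<in> vector_fields A" and Z: "Z \<in> vector_fields A" and W: "W \<in> vector_fields A"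
    and eq: "\<And>Y p. Y \<in> vector_fields A \<Longrightarrow>
      X p (eval2 g Y Z) = g p (D X Y p) (Z p) + g p (Y p) (W p) - \<eta> p (X p) * g p (Y p) (Z p)"
  shows "semi_dual_connection A g \<eta> D X Z = W"
  unfolding semi_dual_connection_def
  by (rule the1_equality[OF semi_dual_connection_ex1[OF D \<eta> X Z]])
    (use eq[unfolded eval2_def] in \<open>simp add: W fun_eq_iff apply_field_def eval1_def eval2_def\<close>)

lemma semi_dual_connection_field:
  assumes "affine_connection A D" "one_form A \<eta>" "X \<in> vector_fields A" "Z \<in> vector_fields A"
  shows "semi_dual_connection A g \<eta> D X Z \<in> vector_fields A"
  using theI'[OF semi_dual_connection_ex1[OF assms]] unfolding semi_dual_connection_def ..

lemma semi_dual_connection_metric: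
  assumes "affine_connection A D" "one_form A \<eta>" "X \<in> vector_fields A" "Z \<in> vector_fields A"
    and Y: "Y \<in> vector_fields A"
  shows "X p (eval2 g Y Z) = g p (D X Y p) (Z p) + g p (Y p) (semi_dual_connection A g \<eta> D X Z p)
    - \<eta> p (X p) * g p (Y p) (Z p)"
proof -
  have "apply_field X (eval2 g Y Z) = eval2 g (D X Y) Z
      + eval2 g Y (semi_dual_connection A g \<eta> D X Z) - eval1 \<eta> X * eval2 g Y Z"
    using theI'[OF semi_dual_connection_ex1[OF assms(1-4)]] Y unfolding semi_dual_connection_def by blast
  from fun_cong[OF this, of p] show ?thesis by (simp add: apply_field_def eval1_def eval2_def)
qed

lemma cp_connection_metric:
  assumes D: "affine_connection A D" and f: "smooth_fun A \<phi>" "smooth_fun A \<psi>"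
    and X: "X \<in> vector_fields A" and Y: "Y \<in> vector_fields A" and Z: "Z \<in> vector_fields A"
  shows "g p (cp_connection A g D \<phi> \<psi> X Y p) (Z p) = g p (D X Y p) (Z p)
    + X p \<phi> * g p (Y p) (Z p) + Y p \<phi> * g p (X p) (Z p) - g p (X p) (Y p) * Z p \<psi>"
proof -
  have "cp_connection A g D \<phi> \<psi> X Y p = D X Y p + cp_tensor A g \<phi> \<psi> X Y p"
    by (simp add: cp_connection_def)
  then show ?thesis
    using metric_add_left[OF vector_field_tangent[OF affine_connection_closed[OF D X Y]]
        vector_field_tangent[OF cp_tensor_field[OF f X Y]] vector_field_tangent[OF Z], of p]
      cp_tensor_metric[OF f X Y Z, of p]
    by (simp only:)
qed

lemma semi_dual_connection_cp:
  assumes D: "affine_connection A D" and \<eta>: "one_form A \<eta>"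
    and f: "smooth_fun A \<phi>" "smooth_fun A \<psi>"
    and X: "X \<in> vector_fields A" and Z: "Z \<in> vector_fields A"
  shows "semi_dual_connection A (cp_metric g \<phi> \<psi>) \<eta> (cp_connection A g D \<phi> \<psi>) X Z
    = semi_dual_connection A g \<eta> D X Z + cp_tensor A g \<psi> \<phi> X Z"
proof -
  \<comment> \<open>The candidate has to be unique with respect to the transformed metric, so the
    locale is instantiated a second time.\<close>
  interpret cp: metric_manifold A "cp_metric g \<phi> \<psi>"
    by unfold_locales (rule cp_metric_pseudo_riemannian[OF f])
  let ?W = "semi_dual_connection A g \<eta> D X Z"
  note W = semi_dual_connection_field[OF D \<eta> X Z] and C = cp_tensor_field[OF f(2,1) X Z]
  show ?thesis
  proof (rule cp.semi_dual_connection_eqI[OF cp_connection_affine[OF D f] \<eta> X Z vector_fields_add[OF W C]])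
    fix Y p assume Y: "Y \<in> vector_fields A"
    note T = vector_field_tangent[of _ p]
    \<comment> \<open>The correction with \<phi> and \<psi> exchanged, brought by symmetry to the
      second slot, where the dual field stands.\<close>
    have W': "g p (Y p) ((?W + cp_tensor A g \<psi> \<phi> X Z) p) = g p (Y p) (?W p)
        + (X p \<psi> * g p (Y p) (Z p) + Z p \<psi> * g p (X p) (Y p) - g p (X p) (Z p) * Y p \<phi>)"
      using metric_add_right[OF T[OF W] T[OF C] T[OF Y]] cp_tensor_metric[OF f(2,1) X Z Y, of p]
        metric_sym[OF T[OF C] T[OF Y]] metric_sym[OF T[OF Z] T[OF Y]] by simp
    show "X p (eval2 (cp_metric g \<phi> \<psi>) Y Z)
        = cp_metric g \<phi> \<psi> p (cp_connection A g D \<phi> \<psi> X Y p) (Z p)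
          + cp_metric g \<phi> \<psi> p (Y p) ((?W + cp_tensor A g \<psi> \<phi> X Z) p)
          - \<eta> p (X p) * cp_metric g \<phi> \<psi> p (Y p) (Z p)"
      unfolding tvec_cp_metric[OF f T[OF X] Y Z]
      unfolding cp_metric_def W' cp_connection_metric[OF D f X Y Z]
        semi_dual_connection_metric[OF D \<eta> X Z Y, of p]
      by (simp only: algebra_simps)
  qed
qed

section \<open>Invariance of the SWMT condition\<close>

lemma SWMT_cp:
  assumes D: "affine_connection A D" and f: "smooth_fun A \<phi>" "smooth_fun A \<psi>"
  shows "SWMT A (cp_metric g \<phi> \<psi>) \<eta> (cp_connection A g D \<phi> \<psi>) \<longleftrightarrow> SWMT A g \<eta> D"
proof -
  let ?g = "cp_metric g \<phi> \<psi>" and ?D = "cp_connection A g D \<phi> \<psi>"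
  have "cov_metric ?D ?g X Y Z + eval1 \<eta> X * eval2 ?g Y Z =
        cov_metric ?D ?g Y X Z + eval1 \<eta> Y * eval2 ?g X Z - eval2 ?g (torsion ?D X Y) Z
      \<longleftrightarrow> cov_metric D g X Y Z + eval1 \<eta> X * eval2 g Y Z =
        cov_metric D g Y X Z + eval1 \<eta> Y * eval2 g X Z - eval2 g (torsion D X Y) Z"
    if X: "X \<in> vector_fields A" and Y: "Y \<in> vector_fields A" and Z: "Z \<in> vector_fields A" for X Y Z
  proof -
    define L where "L p = cov_metric D g X Y Z p + eval1 \<eta> X p * eval2 g Y Z p
      - (cov_metric D g Y X Z p + eval1 \<eta> Y p * eval2 g X Z p - eval2 g (torsion D X Y) Z p)" for p
    define L' where "L' p = cov_metric ?D ?g X Y Z p + eval1 \<eta> X p * eval2 ?g Y Z p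
      - (cov_metric ?D ?g Y X Z p + eval1 \<eta> Y p * eval2 ?g X Z p - eval2 ?g (torsion ?D X Y) Z p)" for p
    have tor: "torsion ?D X Y = torsion D X Y"
      using cp_tensor_sym[OF X Y, of \<phi> \<psi>] by (simp add: torsion_def cp_connection_def fun_eq_iff)
    \<comment> \<open>With \<chi> = \<psi> - \<phi> the extra terms are d\<chi>(X) g(Y,Z) +
      d\<chi>(Y) g(X,Z) + d\<chi>(Z) g(X,Y). This is totally symmetric, so it disappears from the
      difference between the formula for \<open>X\<close>, \<open>Y\<close> and the one for
      \<open>Y\<close>, \<open>X\<close>; both orders are needed, hence the fresh variables.\<close>
    have cov: "cov_metric ?D ?g X Y Z p = exp (\<phi> p + \<psi> p) * (cov_metric D g X Y Z p
        + (X p \<psi> - X p \<phi>) * g p (Y p) (Z p) - Y p \<phi> * g p (X p) (Z p) - Z p \<phi> * g p (X p) (Y p)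
        + Z p \<psi> * g p (X p) (Y p) + Y p \<psi> * g p (X p) (Z p))"
      if X: "X \<in> vector_fields A" and Y: "Y \<in> vector_fields A" for X Y p
    proof -
      note T = vector_field_tangent[of _ p]
      note DZ = affine_connection_closed[OF D X Z]
        and DZ' = affine_connection_closed[OF cp_connection_affine[OF D f] X Z]
      have DYZ: "g p (Y p) (?D X Z p) = g p (Y p) (D X Z p)
          + X p \<phi> * g p (Y p) (Z p) + Z p \<phi> * g p (X p) (Y p) - g p (X p) (Z p) * Y p \<psi>"
        unfolding metric_sym[OF T[OF Y] T[OF DZ']] metric_sym[OF T[OF Y] T[OF DZ]]
          metric_sym[OF T[OF Y] T[OF Z]]
        by (rule cp_connection_metric[OF D f X Z Y])
      have "cov_metric ?D ?g X Y Z p = X p (eval2 ?g Y Z)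
          - exp (\<phi> p + \<psi> p) * g p (?D X Y p) (Z p) - exp (\<phi> p + \<psi> p) * g p (Y p) (?D X Z p)"
        by (simp add: cov_metric_def apply_field_def eval2_def cp_metric_def)
      moreover have cov: "cov_metric D g X Y Z p
          = X p (eval2 g Y Z) - g p (D X Y p) (Z p) - g p (Y p) (D X Z p)"
        by (simp add: cov_metric_def apply_field_def eval2_def)
      ultimately show ?thesis
        unfolding tvec_cp_metric[OF f T[OF X] Y Z] cp_connection_metric[OF D f X Y Z] DYZ cov
        by (simp add: algebra_simps)
    qed
    have "L' p = exp (\<phi> p + \<psi> p) * L p" for p
      using metric_sym[OF vector_field_tangent[OF X, of p] vector_field_tangent[OF Y, of p]]
      unfolding L_def L'_def tor cov[OF X Y] cov[OF Y X]
      unfolding eval2_def cp_metric_def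
      by (simp add: algebra_simps)
    then have "(\<forall>p. L' p = 0) \<longleftrightarrow> (\<forall>p. L p = 0)" by simp
    then show ?thesis by (simp add: L_def L'_def fun_eq_iff)
  qed
  then show ?thesis
    using metric D cp_metric_pseudo_riemannian[OF f] cp_connection_affine[OF D f]
    by (simp add: SWMT_def)
qed

end

theorem proposition3p2:
  fixes A :: "('a::{t2_space,second_countable_topology}, 'e::euclidean_space) atlas"
    and g g' :: "'a form2" and D D' :: "'a connection" and \<eta> :: "'a form1"
    and \<phi> \<psi> :: "'a \<Rightarrow> real"
  assumes "smooth_manifold A"
    and "pseudo_riemannian_metric A g"
    and "affine_connection A D"
    and "one_form A \<eta>"
    and "smooth_fun A \<phi>" and "smooth_fun A \<psi>"
    and "g' = cp_metric g \<phi> \<psi>"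
    and "D' = cp_connection A g D \<phi> \<psi>"
  shows "((SWMT A g \<eta> D \<longleftrightarrow> SWMT A g' \<eta> D') \<and>
      (\<forall>X\<in>vector_fields A. \<forall>Y\<in>vector_fields A.
         semi_dual_connection A g' \<eta> D' X Y =
         semi_dual_connection A g \<eta> D X Y + cp_tensor A g \<psi> \<phi> X Y)) \<and>
     ((SMT A g D \<longleftrightarrow> SMT A g' D') \<and>
      (\<forall>X\<in>vector_fields A. \<forall>Y\<in>vector_fields A.
         dual_connection A g' D' X Y =
         dual_connection A g D X Y + cp_tensor A g \<psi> \<phi> X Y))"
proof -
  interpret metric_manifold A g using assms(1,2) by unfold_locales
  \<comment> \<open>After rewriting with \<open>SWMT_cp\<close> both equivalences are trivial, and
    the two formulas for duals are one statement, taken once at \<eta> and once at the zero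
    form.\<close>
  show ?thesis
    unfolding assms(7,8) SMT_eq_SWMT dual_connection_eq_semi_dual SWMT_cp[OF assms(3,5,6)]
    using semi_dual_connection_cp[OF assms(3) _ assms(5,6)] assms(4) one_form_zero by blast
qed

end
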